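(* There is a universal constant $c_2 > 0$ such that every planar geodesic metric space and every planar graph has Nagata dimension at most $2$ with constant $c_2$.
   Context: A geodesic metric space is called planar if it admits an injective continuous map into $\mathbb{R}^2$. A graph is assumed to be connected but not necessarily locally finite, and is viewed as a geodesic metric space with edges of length one; it is called planar if it admits an injective map into $\mathbb{R}^2$ whose restriction to every edge is continuous. Let $(X,d)$ be a metric space. A collection $\mathscr{C}$ of subsets of $X$ is called $D$-bounded, for a constant $D$, if every $C \in \mathscr{C}$ has diameter $\operatorname{diam}(C) := \sup\{d(x,y) : x,y \in C\} \le D$. For $s > 0$, the $s$-multiplicity of $\mathscr{C}$ is the infimum of all integers $m \ge 0$ such that every closed ball of radius $s$ in $X$ meets at most $m$ members of $\mathscr{C}$. The space $X$ has Nagata dimension at most $n$ with constant $c > 0$ if for every $s > 0$, $X$ possesses a $cs$-bounded covering of $s$-multiplicity at most $n+1$. *)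

theory Defs
  imports "HOL-Analysis.Analysis" "Graph_Theory.Digraph_Component"
begin

section \<open>Nagata dimension\<close>

text \<open>The diameter is taken in the extended reals, so that it is infinite for unbounded sets
  (and minus infinity for the empty set).\<close>

definition diam :: "'a metric \<Rightarrow> 'a set \<Rightarrow> ereal" where
  "diam m C = Sup {ereal (mdist m x y) |x y. x \<in> C \<and> y \<in> C}"

definition bounded_family :: "'a metric \<Rightarrow> real \<Rightarrow> 'a set set \<Rightarrow> bool" where
  "bounded_family m D \<C> \<longleftrightarrow> (\<forall>C\<in>\<C>. diam m C \<le> ereal D)"

text \<open>The infimum is \<open>\<infinity>\<close> if no \<open>k\<close> qualifies. The finiteness conjunct is needed because
  \<^const>\<open>card\<close> is \<open>0\<close> on infinite sets.\<close>

definition multiplicity_at :: "'a metric \<Rightarrow> real \<Rightarrow> 'a set set \<Rightarrow> enat" where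
  "multiplicity_at m s \<C> = Inf {enat k |k. \<forall>x\<in>mspace m.
     finite {C\<in>\<C>. C \<inter> mcball_of m x s \<noteq> {}} \<and> card {C\<in>\<C>. C \<inter> mcball_of m x s \<noteq> {}} \<le> k}"

definition nagata_dim_le :: "'a metric \<Rightarrow> nat \<Rightarrow> real \<Rightarrow> bool" where
  "nagata_dim_le m n c \<longleftrightarrow> c > 0 \<and> (\<forall>s>0. \<exists>\<C>. \<C> \<subseteq> Pow (mspace m) \<and> \<Union>\<C> = mspace m \<and>
     bounded_family m (c * s) \<C> \<and> multiplicity_at m s \<C> \<le> enat (n + 1))"


section \<open>Planar geodesic metric spaces\<close>

definition geodesic_space :: "'a metric \<Rightarrow> bool" where
  "geodesic_space m \<longleftrightarrow> (\<forall>x\<in>mspace m. \<forall>y\<in>mspace m. \<exists>\<gamma>.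
     \<gamma> \<in> {0..mdist m x y} \<rightarrow> mspace m \<and> \<gamma> 0 = x \<and> \<gamma> (mdist m x y) = y \<and>
     (\<forall>s\<in>{0..mdist m x y}. \<forall>t\<in>{0..mdist m x y}. mdist m (\<gamma> s) (\<gamma> t) = \<bar>s - t\<bar>))"

definition planar_space :: "'a metric \<Rightarrow> bool" where
  "planar_space m \<longleftrightarrow>
     (\<exists>f :: 'a \<Rightarrow> real^2. continuous_map (mtopology_of m) euclidean f \<and> inj_on f (mspace m))"


section \<open>Graphs as metric spaces\<close>

text \<open>
  A graph is a \<^typ>\<open>('v,'e) pre_digraph\<close> each of whose arcs is one (undirected) edge: the direction
  \<open>tail \<rightarrow> head\<close> serves only to parametrise the edge by \<open>[0,1]\<close> and affects neither the metric
  nor connectedness. Loops and multiple edges are allowed; a simple graph is obtained by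
  choosing one direction for every edge. There is no finiteness assumption. The library notion of
  connectedness excludes the null graph.

  The points of the geometric realization are the vertices together with the interior points
  \<open>Inner e t\<close>, \<open>0 < t < 1\<close>, of the edges.\<close>

datatype ('v, 'e) graph_point = Vertex 'v | Inner 'e real

definition graph_points :: "('v, 'e) pre_digraph \<Rightarrow> ('v, 'e) graph_point set" where
  "graph_points G = Vertex ` verts G \<union> {Inner e t |e t. e \<in> arcs G \<and> 0 < t \<and> t < 1}"

definition edge_point :: "('v, 'e) pre_digraph \<Rightarrow> 'e \<Rightarrow> real \<Rightarrow> ('v, 'e) graph_point" where
  "edge_point G e t =
     (if t = 0 then Vertex (tail G e) else if t = 1 then Vertex (head G e) else Inner e t)"

definition closed_edge :: "('v, 'e) pre_digraph \<Rightarrow> 'e \<Rightarrow> ('v, 'e) graph_point set" where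
  "closed_edge G e = edge_point G e ` {0..1}"

text \<open>\<open>pl_path G x y l\<close>: there is a piecewise linear path of length \<open>l\<close> from \<open>x\<close> to \<open>y\<close>, that is,
  a finite concatenation of segments each of which lies in one closed edge.\<close>

inductive pl_path ::
  "('v, 'e) pre_digraph \<Rightarrow> ('v, 'e) graph_point \<Rightarrow> ('v, 'e) graph_point \<Rightarrow> real \<Rightarrow> bool"
  for G where
  refl: "x \<in> graph_points G \<Longrightarrow> pl_path G x x 0"
| step: "e \<in> arcs G \<Longrightarrow> s \<in> {0..1} \<Longrightarrow> t \<in> {0..1} \<Longrightarrow> pl_path G (edge_point G e t) y l \<Longrightarrow>
         pl_path G (edge_point G e s) y (\<bar>s - t\<bar> + l)"

text \<open>The value \<open>0\<close> off the carrier is immaterial; it makes the function nonnegative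
  everywhere, as \<^locale>\<open>Metric_space\<close> demands.\<close>

definition graph_dist :: "('v, 'e) pre_digraph \<Rightarrow> ('v, 'e) graph_point \<Rightarrow> ('v, 'e) graph_point \<Rightarrow> real"
  where "graph_dist G x y =
    (if x \<in> graph_points G \<and> y \<in> graph_points G then Inf {l. pl_path G x y l} else 0)"

definition graph_metric :: "('v, 'e) pre_digraph \<Rightarrow> ('v, 'e) graph_point metric" where
  "graph_metric G = metric (graph_points G, graph_dist G)"

definition connected_graph :: "('v, 'e) pre_digraph \<Rightarrow> bool" where
  "connected_graph G \<longleftrightarrow> wf_digraph G \<and> Digraph_Component.connected G"

definition planar_graph :: "('v, 'e) pre_digraph \<Rightarrow> bool" where
  "planar_graph G \<longleftrightarrow> (\<exists>f :: ('v, 'e) graph_point \<Rightarrow> real^2. inj_on f (graph_points G) \<and>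
     (\<forall>e\<in>arcs G. continuous_map
        (subtopology (mtopology_of (graph_metric G)) (closed_edge G e)) euclidean f))"

lemma pl_path_points:
  assumes "wf_digraph G" "pl_path G x y l"
  shows "x \<in> graph_points G \<and> y \<in> graph_points G \<and> 0 \<le> l"
  using assms(2,1)
proof (induction rule: pl_path.induct)
  case (step e s t y l)
  then show ?case
    by (auto simp: graph_points_def edge_point_def wf_digraph.tail_in_verts wf_digraph.head_in_verts)
qed auto

lemma pl_path_trans:
  assumes "pl_path G x y l" "pl_path G y z k"
  shows "pl_path G x z (l + k)"
  using assms
proof (induction rule: pl_path.induct)
  case (step e s t y l)
  then show ?case using pl_path.step[of e G s t z "l + k"] by (simp add: add.assoc)
qed auto

lemma edge_point_in: "wf_digraph G \<Longrightarrow> e \<in> arcs G \<Longrightarrow> s \<in> {0..1} \<Longrightarrow> edge_point G e s \<in> graph_points G"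
  by (auto simp: graph_points_def edge_point_def wf_digraph.tail_in_verts wf_digraph.head_in_verts)

lemma pl_path_edge:
  assumes "wf_digraph G" "e \<in> arcs G" "s \<in> {0..1}" "t \<in> {0..1}"
  shows "pl_path G (edge_point G e s) (edge_point G e t) \<bar>s - t\<bar>"
  using pl_path.step[OF assms(2-4) pl_path.refl] edge_point_in[OF assms(1,2,4)] by simp

lemma pl_path_sym:
  assumes "wf_digraph G" "pl_path G x y l"
  shows "pl_path G y x l"
  using assms(2,1)
proof (induction rule: pl_path.induct)
  case (step e s t y l)
  have "pl_path G (edge_point G e t) (edge_point G e s) \<bar>t - s\<bar>"
    using pl_path_edge step by metis
  then have "pl_path G y (edge_point G e s) (l + \<bar>t - s\<bar>)"
    using pl_path_trans step by metis
  then show ?case by (simp add: abs_minus_commute add.commute)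
qed (auto intro: pl_path.refl)

lemma pl_path_exists:
  assumes G: "connected_graph G" and x: "x \<in> graph_points G" and y: "y \<in> graph_points G"
  shows "\<exists>l. pl_path G x y l"
proof -
  have wf: "wf_digraph G" using G by (simp add: connected_graph_def)
  have V: "\<exists>l. pl_path G (Vertex u) (Vertex v) l" if "u \<in> verts G" "v \<in> verts G" for u v
  proof -
    have "u \<rightarrow>\<^sup>*\<^bsub>with_proj (mk_symmetric G)\<^esub> v"
      using G that
      by (auto simp: connected_graph_def Digraph_Component.connected_def strongly_connected_def)
    then have "(u, v) \<in> rtrancl_on (verts G) (parcs (mk_symmetric G))"
      by (simp add: reachable_def)
    then show ?thesis
    proof (induction rule: rtrancl_on.induct)
      case (rtrancl_on_refl v)
      then show ?case by (auto simp: graph_points_def intro!: exI pl_path.refl)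
    next
      case (rtrancl_on_into_rtrancl_on u v w)
      then obtain e where e: "e \<in> arcs G" "(v = tail G e \<and> w = head G e) \<or> (w = tail G e \<and> v = head G e)"
        by (auto simp: parcs_mk_symmetric)
      have "\<exists>l. pl_path G (Vertex v) (Vertex w) l"
        using pl_path_edge[OF wf e(1), of 0 1] pl_path_edge[OF wf e(1), of 1 0] e(2)
        by (auto simp: edge_point_def)
      then show ?case using rtrancl_on_into_rtrancl_on pl_path_trans by metis
    qed
  qed
  have P: "\<exists>v\<in>verts G. \<exists>l. pl_path G z (Vertex v) l" if z: "z \<in> graph_points G" for z
  proof (cases z)
    case (Vertex v)
    then show ?thesis using z pl_path.refl[OF z] by (auto simp: graph_points_def)
  next
    case (Inner e t)
    then have e: "e \<in> arcs G" "0 < t" "t < 1" using z by (auto simp: graph_points_def)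
    show ?thesis
      using pl_path_edge[OF wf e(1), of t 0] e wf_digraph.tail_in_verts[OF wf e(1)] Inner
      by (auto simp: edge_point_def)
  qed
  show ?thesis using P[OF x] P[OF y] V pl_path_trans pl_path_sym[OF wf] by metis
qed

text \<open>A function that is 1-Lipschitz along every edge bounds the length of paths from below.\<close>

lemma pl_path_lipschitz:
  assumes "pl_path G x y l"
    and "\<And>e s t. e \<in> arcs G \<Longrightarrow> s \<in> {0..1} \<Longrightarrow> t \<in> {0..1} \<Longrightarrow>
           \<phi> (edge_point G e t) - \<phi> (edge_point G e s) \<le> \<bar>s - t\<bar>"
  shows "\<phi> y - \<phi> x \<le> (l::real)"
  using assms(1)
proof (induction rule: pl_path.induct)
  case (step e s t y l)
  then show ?case using assms(2)[of e s t] by linarith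
qed auto

lemma pl_path_positive:
  assumes wf: "wf_digraph G" and x: "x \<in> graph_points G" and y: "y \<in> graph_points G" and "x \<noteq> y"
  shows "\<exists>\<delta>>0. \<forall>l. pl_path G x y l \<longrightarrow> \<delta> \<le> l"
proof (cases x)
  case (Vertex v)
  define \<phi> where "\<phi> z = (case z of Vertex w \<Rightarrow> if w = v then 0 else 1/2 |
     Inner e s \<Rightarrow> min (1/2) (min (if tail G e = v then s else 1/2) (if head G e = v then 1 - s else 1/2)))"
    for z :: "('a, 'b) graph_point"
  have \<phi>_edge: "\<phi> (edge_point G e s) =
      min (1/2) (min (if tail G e = v then s else 1/2) (if head G e = v then 1 - s else 1/2))"
    if "s \<in> {0..1}" for e s
    using that by (auto simp: \<phi>_def edge_point_def)
  have L: "\<phi> (edge_point G e t) - \<phi> (edge_point G e s) \<le> \<bar>s - t\<bar>"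
    if "s \<in> {0..1}" "t \<in> {0..1}" for e s t
    using that unfolding \<phi>_edge[OF that(1)] \<phi>_edge[OF that(2)] by (auto simp: min_def)
  have "\<phi> y \<le> l" if "pl_path G x y l" for l
  proof -
    have "\<phi> x = 0" by (simp add: \<phi>_def Vertex)
    then show ?thesis using pl_path_lipschitz[OF that, of \<phi>] L by simp
  qed
  moreover have "\<phi> y > 0"
    using y \<open>x \<noteq> y\<close> by (auto simp: \<phi>_def Vertex graph_points_def split: graph_point.splits)
  ultimately show ?thesis by blast
next
  case (Inner e0 t0)
  then have t0: "0 < t0" "t0 < 1" using x by (auto simp: graph_points_def)
  define r where "r = min t0 (1 - t0)"
  define \<phi> where "\<phi> z = (case z of Vertex w \<Rightarrow> r |
     Inner e s \<Rightarrow> if e = e0 then min r \<bar>s - t0\<bar> else r)"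
    for z :: "('a, 'b) graph_point"
  have \<phi>_edge: "\<phi> (edge_point G e s) = (if e = e0 then min r \<bar>s - t0\<bar> else r)"
    if "s \<in> {0..1}" for e s
    using that t0 by (auto simp: \<phi>_def edge_point_def r_def)
  have L: "\<phi> (edge_point G e t) - \<phi> (edge_point G e s) \<le> \<bar>s - t\<bar>"
    if "s \<in> {0..1}" "t \<in> {0..1}" for e s t
    using that unfolding \<phi>_edge[OF that(1)] \<phi>_edge[OF that(2)] by (auto simp: min_def)
  have "\<phi> y \<le> l" if "pl_path G x y l" for l
  proof -
    have "\<phi> x = 0" using t0 by (simp add: \<phi>_def Inner r_def)
    then show ?thesis using pl_path_lipschitz[OF that, of \<phi>] L by simp
  qed
  moreover have "\<phi> y > 0"
    using t0 \<open>x \<noteq> y\<close> by (auto simp: \<phi>_def Inner r_def split: graph_point.splits)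
  ultimately show ?thesis by blast
qed

lemma Metric_space_graph:
  assumes G: "connected_graph G"
  shows "Metric_space (graph_points G) (graph_dist G)"
proof -
  have wf: "wf_digraph G" using G by (simp add: connected_graph_def)
  note ex = pl_path_exists[OF G] and pts = pl_path_points[OF wf]
  have bdd: "bdd_below {l. pl_path G x y l}" for x y
    using pts by (auto intro!: bdd_belowI[of _ 0])
  have le: "graph_dist G x y \<le> l" if "pl_path G x y l" for x y l
    using that pts[OF that] bdd by (auto simp: graph_dist_def intro!: cInf_lower)
  have ge: "b \<le> graph_dist G x y"
    if "x \<in> graph_points G" "y \<in> graph_points G" "\<And>l. pl_path G x y l \<Longrightarrow> b \<le> l" for x y b
    using that ex[of x y] by (auto simp: graph_dist_def intro!: cInf_greatest)
  show ?thesis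
  proof
    fix x y
    show "0 \<le> graph_dist G x y"
      using ge[of x y 0] pts by (cases "x \<in> graph_points G \<and> y \<in> graph_points G") (auto simp: graph_dist_def)
    have "{l. pl_path G x y l} = {l. pl_path G y x l}" using pl_path_sym[OF wf] by blast
    then show "graph_dist G x y = graph_dist G y x" by (simp add: graph_dist_def conj_commute)
  next
    fix x y assume xy: "x \<in> graph_points G" "y \<in> graph_points G"
    have "graph_dist G x y > 0" if "x \<noteq> y"
      using pl_path_positive[OF wf xy that] ge[OF xy] by (meson less_le_trans)
    moreover have "graph_dist G x x = 0"
      using le[OF pl_path.refl[OF xy(1)]] ge[OF xy(1) xy(1), of 0] pts by fastforce
    ultimately show "(graph_dist G x y = 0) = (x = y)" by fastforce
  next
    fix x y z assume xyz: "x \<in> graph_points G" "y \<in> graph_points G" "z \<in> graph_points G"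
    have "graph_dist G x z - k \<le> graph_dist G x y" if k: "pl_path G y z k" for k
      using ge[OF xyz(1,2), of "graph_dist G x z - k"] le[OF pl_path_trans[OF _ k]] by fastforce
    then have "graph_dist G x z - graph_dist G x y \<le> graph_dist G y z"
      by (intro ge xyz) fastforce
    then show "graph_dist G x z \<le> graph_dist G x y + graph_dist G y z" by linarith
  qed
qed

lemma graph_metric_simps:
  assumes "connected_graph G"
  shows "mspace (graph_metric G) = graph_points G" "mdist (graph_metric G) = graph_dist G"
  using Metric_space_graph[OF assms]
  by (simp_all add: graph_metric_def Metric_space.mspace_metric Metric_space.mdist_metric)


section \<open>The universal constant\<close>

text \<open>
  HOL cannot quantify over types below an existential quantifier, so a constant that is the same for
  spaces over all types has to be a closed term. Every planar space or graph has
  an isomorphic copy over \<^typ>\<open>real^2\<close>, so if there is a universal constant at all, then the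
  constant chosen here is one. The choice itself asserts nothing, neither existence nor positivity.\<close>

definition c\<^sub>2 :: real where
  "c\<^sub>2 = (SOME c. c > 0 \<and>
     (\<forall>m :: (real^2) metric. geodesic_space m \<and> planar_space m \<longrightarrow> nagata_dim_le m 2 c) \<and>
     (\<forall>G :: (real^2, real^2) pre_digraph.
        connected_graph G \<and> planar_graph G \<longrightarrow> nagata_dim_le (graph_metric G) 2 c))"

end

theory Submission
  imports Defs
begin

hide_const (open) Digraph_Component.connected

text \<open>
  Fix a point \<open>z\<close> and consider an annulus around \<open>z\<close> of width comparable to \<open>\<sigma>\<close>, with its inner path
  metric. Cut each component into pieces of width comparable to \<open>\<sigma>\<close> by the inner distance to some base
  point \<open>p\<close>. If a connected piece contained three points far apart, then the piece, a ball around \<open>p\<close>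
  and a ball around \<open>z\<close> on one side, and the ends of almost shortest paths from \<open>p\<close> to the three
  points on the other side would form a complete bipartite graph with three plus three vertices in
  the plane. So the pieces are bounded, and each annulus has a bounded covering by two separated
  families. Coverings of consecutive annuli are glued along much thinner annuli around their common
  boundary spheres.

  Non-planarity of the bipartite graph is deduced from Janiszewski's theorem. To treat spaces and
  graphs alike, only points joined by almost shortest Lipschitz paths with continuous image in
  the plane are considered: an embedding of a graph need not be continuous at
  vertices of infinite degree.\<close>

section \<open>Non-planarity of the complete bipartite graph with three plus three vertices\<close>

text \<open>Two colours on each side of a boundary sphere could show four pieces to one small ball.
  The saving comes from a Lebesgue property of the colourings: every set of diameter at most the
  scale lies in one piece. So a coarse piece can absorb a whole fine piece, one colour at a time.
  This costs two applications of the annulus estimate: at scale \<open>18 * s\<close>, giving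
  diameters \<open>137 * 18 * s = 2466 * s\<close>, and at scale \<open>2466 * s\<close>, giving
  \<open>137 * 2466 * s = 337842 * s\<close>. The factor 137: only the last stretch of each path
  from \<open>p\<close> is an arm of the drawing, and it stays within \<open>31 * \<sigma>\<close>
  of its end, while a leg from \<open>z\<close> covers at most \<open>6 * \<sigma>\<close> before
  its end from any point on the drawing. Three points more than \<open>31 + 31 + 6 = 68\<close>
  units of \<open>\<sigma>\<close> apart suffice, and these are found on a connected piece with two
  points more than \<open>137 * \<sigma>\<close> apart. The obstacle in the drawing is that the legs
  from \<open>z\<close> may cross each other and run along their own arm. Hence \<open>z\<close>
  enters the topology only through connected sets that avoid the other arms and the other two
  vertices.\<close>

lemma arc_to_closed_set:
  fixes K Q :: "'a::{real_normed_vector, complete_space} set"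
  assumes Q: "path_connected Q" and K: "closed K" "Q \<inter> K \<noteq> {}" and x: "x \<in> Q" "x \<notin> K"
  obtains g where "arc g" "path_image g \<subseteq> Q" "pathstart g = x" "path_image g \<inter> K = {pathfinish g}"
proof -
  obtain y where "y \<in> Q" "y \<in> K" using K by auto
  then obtain p where p: "path p" "path_image p \<subseteq> Q" "pathstart p = x" "pathfinish p = y"
    using Q x unfolding path_connected_def by meson
  obtain h where h: "path h" "pathstart h = pathstart p" "path_image h \<subseteq> path_image p"
    "path_image h - {pathfinish h} \<subseteq> interior (- K)" "pathfinish h \<in> frontier (- K)"
    using exists_path_subpath_to_frontier[of p "- K"] p x \<open>y \<in> K\<close> closure_subset[of "- K"] by auto
  have hK: "pathfinish h \<in> K"
    using h(5) K(1) by (simp add: frontier_def interior_open open_Compl)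
  then obtain g where g: "arc g" "path_image g \<subseteq> path_image h" "pathstart g = x" "pathfinish g = pathfinish h"
    using path_contains_arc[of h x "pathfinish h"] h(1,2) p(3) x by metis
  have "path_image g \<inter> K \<subseteq> {pathfinish g}"
    using g h(4) interior_subset[of "- K"] by auto
  moreover have "pathfinish g \<in> path_image g" by (rule pathfinish_in_path_image)
  ultimately have "path_image g \<inter> K = {pathfinish g}" using hK g(4) by auto
  then show thesis using that[of g] g h p by auto
qed

text \<open>Replaces a tree drawn in the plane. Gluing at one point preserves these properties by
  Janiszewski's theorem, so no combinatorial structure has to be carried along.\<close>

definition treelike :: "complex set \<Rightarrow> bool" where
  "treelike K \<longleftrightarrow> compact K \<and> connected K \<and> connected (- K)"

lemma treelike_arc: "arc g \<Longrightarrow> treelike (path_image g)"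
  by (simp add: treelike_def compact_arc_image connected_arc_image connected_arc_complement)

lemma treelike_Un:
  assumes "treelike S" "treelike T" "S \<inter> T = {x}"
  shows "treelike (S \<union> T)"
  using assms Janiszewski_connected[of S T]
  by (auto simp: treelike_def compact_imp_closed intro!: connected_Un)

text \<open>An arc from \<open>x\<close> inside \<open>Q\<close>, stopped at its first point on
  \<open>K\<close>, meets \<open>K\<close> only once, so \<open>treelike_Un\<close> applies.\<close>

lemma treelike_extend:
  assumes Q: "path_connected Q" and K: "treelike K" "K \<subseteq> Q" "K \<noteq> {}" and x: "x \<in> Q"
  obtains K' where "treelike K'" "K \<subseteq> K'" "K' \<subseteq> Q" "x \<in> K'"
proof (cases "x \<in> K")
  case False
  have "closed K" using K by (simp add: treelike_def compact_imp_closed)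
  then obtain g where g: "arc g" "path_image g \<subseteq> Q" "pathstart g = x" "path_image g \<inter> K = {pathfinish g}"
    using arc_to_closed_set[OF Q _ _ x False] K by blast
  show thesis
  proof (rule that[of "path_image g \<union> K"])
    show "treelike (path_image g \<union> K)" using treelike_Un treelike_arc g K by blast
    show "x \<in> path_image g \<union> K" using g(3) pathstart_in_path_image[of g] by auto
  qed (use g K in auto)
qed (use that K in auto)

text \<open>A path connected set may separate the plane. This extracts a non-separating part that
  still contains the three points where arms are attached.\<close>

lemma treelike_three_points:
  assumes Q: "path_connected Q" and "a \<in> Q" "b \<in> Q" "c \<in> Q"
  obtains K where "treelike K" "K \<subseteq> Q" "a \<in> K" "b \<in> K" "c \<in> K"
proof -
  have "treelike {a}" by (simp add: treelike_def connected_punctured_universe)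
  then obtain K1 where K1: "treelike K1" "{a} \<subseteq> K1" "K1 \<subseteq> Q" "b \<in> K1"
    using treelike_extend[OF Q, of "{a}" b] assms by auto
  then obtain K2 where "treelike K2" "K1 \<subseteq> K2" "K2 \<subseteq> Q" "c \<in> K2"
    using treelike_extend[OF Q, of K1 c] assms by auto
  then show thesis using that K1 by blast
qed

lemma arc_minus_pathfinish:
  assumes "arc g"
  shows "path_image g - {pathfinish g} = g ` {0..<1}" "connected (path_image g - {pathfinish g})"
proof -
  have "inj_on g {0..1}" using assms by (simp add: arc_def)
  then show eq: "path_image g - {pathfinish g} = g ` {0..<1}"
  proof -
    assume inj: "inj_on g {0..1}"
    have "{0..1} = insert 1 {0..<1::real}" by auto
    then have "path_image g = insert (g 1) (g ` {0..<1})" by (simp add: path_image_def)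
    moreover have "g 1 \<notin> g ` {0..<1}" using inj by (force simp: inj_on_def)
    ultimately show ?thesis by (auto simp: pathfinish_def)
  qed
  have "continuous_on {0..<1} g"
    using assms by (auto simp: arc_def path_def intro: continuous_on_subset)
  then show "connected (path_image g - {pathfinish g})"
    unfolding eq by (intro connected_continuous_image) auto
qed

text \<open>Since \<open>P \<union> S \<union> L\<close> does not separate the plane, the complementary component of \<open>v\<close> must
  have a boundary point on \<open>T\<close>.\<close>

lemma theta_component_reaches:
  assumes tl: "treelike P" "treelike L" "treelike S"
    and cT: "compact T" "connected (T - P - L)"
    and p: "P \<inter> S = {p}" and l: "L \<inter> S = {l}" and PL: "P \<inter> L = {}"
    and ST: "S \<inter> T = {}" and RR: "S \<inter> R = {}" "T \<inter> R = {}"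
    and Rz: "\<And>y. y \<in> R - P - L \<Longrightarrow> connected_component (- (P \<union> L \<union> S \<union> T)) z y"
    and v: "v \<notin> P \<union> L \<union> S \<union> T" and z: "z \<notin> P \<union> L \<union> S \<union> T"
    and vz: "\<not> connected_component (- (P \<union> L \<union> S \<union> T)) z v"
    and q: "q \<in> T - P - L"
  shows "connected_component (- (P \<union> L \<union> S \<union> R)) v q"
proof -
  let ?E = "P \<union> L \<union> S \<union> T"
  let ?V = "connected_component_set (- ?E) v"
  have "closed ?E" using tl cT by (simp add: treelike_def closed_Un compact_imp_closed)
  then have oV: "open ?V" by (intro open_connected_component open_Compl)
  have "treelike (P \<union> S \<union> L)"
    using treelike_Un[OF treelike_Un[OF tl(1,3) p] tl(2), of l] l PL by (auto simp: Int_Un_distrib2 Int_commute)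
  then have con: "connected (- (P \<union> S \<union> L))" by (simp add: treelike_def)
  have vV: "v \<in> ?V" using v by (simp add: connected_component_refl_eq)
  have Vsub: "?V \<subseteq> - ?E" by (rule connected_component_subset)
  have zV: "z \<notin> ?V" using vz by (auto intro: connected_component_sym)
  have "\<exists>y \<in> closure ?V. y \<in> T - P - L"
  proof (rule ccontr)
    assume no: "\<not> ?thesis"
    have "closure ?V \<inter> - (P \<union> S \<union> L) \<subseteq> ?V"
    proof
      fix y assume y: "y \<in> closure ?V \<inter> - (P \<union> S \<union> L)"
      then have yE: "y \<in> - ?E" using no by auto
      have "connected (insert y ?V)"
        by (rule connected_intermediate_closure[of ?V]) (use y closure_subset[of ?V] in blast)+
      then have "insert y ?V \<subseteq> ?V"
        by (rule connected_component_maximal[rotated]) (use vV yE Vsub in blast)+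
      then show "y \<in> ?V" by simp
    qed
    then have "?V = - (P \<union> S \<union> L) \<inter> closure ?V"
      using closure_subset[of ?V] Vsub by blast
    then have "closedin (top_of_set (- (P \<union> S \<union> L))) ?V"
      using closedin_closed closed_closure by metis
    moreover have "openin (top_of_set (- (P \<union> S \<union> L))) ?V"
      using oV Vsub by (auto simp: openin_open)
    ultimately have "?V = {} \<or> ?V = - (P \<union> S \<union> L)"
      using con by (auto simp: connected_clopen)
    then show False using vV zV z by blast
  qed
  then obtain y where y: "y \<in> closure ?V" "y \<in> T - P - L" by blast
  \<comment> \<open>Off \<open>P\<close> and \<open>L\<close> the third arm \<open>R\<close> lies in
    the component of \<open>z\<close>, so joining \<open>?V\<close> to \<open>T\<close> produces no
    contact with \<open>R\<close>.\<close>
  have VR: "?V \<inter> R = {}"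
  proof (rule ccontr)
    assume "?V \<inter> R \<noteq> {}"
    then obtain w where w: "w \<in> ?V" "w \<in> R" by auto
    then have "w \<in> R - P - L" using Vsub by auto
    then have "connected_component (- ?E) z w" by (rule Rz)
    moreover have "connected_component (- ?E) v w" using w by simp
    ultimately show False using vz by (meson connected_component_sym connected_component_trans)
  qed
  have "connected (insert y ?V)"
    by (rule connected_intermediate_closure[of ?V]) (use y closure_subset[of ?V] in blast)+
  then have "connected (insert y ?V \<union> (T - P - L))"
    using cT y by (intro connected_Un) auto
  moreover have "insert y ?V \<union> (T - P - L) \<subseteq> - (P \<union> L \<union> S \<union> R)"
    using Vsub VR y ST RR by auto
  ultimately show ?thesis
    using vV q by (auto simp: connected_component_def)
qed

text \<open>The arms \<open>T 0\<close> and \<open>T 1\<close> close up with \<open>P\<close> and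
  \<open>L\<close> to a set that separates the plane, so some \<open>v\<close> is cut off from
  \<open>z\<close>, whereas \<open>T 2\<close> is on the side of \<open>z\<close>. The component of
  \<open>v\<close> reaches both \<open>T 0\<close> and \<open>T 1\<close>; hence \<open>v\<close>
  can be joined to \<open>z\<close> through \<open>q 0\<close> when \<open>T 0\<close> is removed
  from the obstacle, and through \<open>q 1\<close> when \<open>T 1\<close> is removed.
  Janiszewski's theorem merges the two connections into one that avoids everything, a
  contradiction.\<close>

lemma no_theta_with_apex:
  fixes T :: "nat \<Rightarrow> complex set"
  assumes P: "treelike P" and L: "treelike L" and PL: "P \<inter> L = {}"
    and T: "\<And>i. i < 3 \<Longrightarrow> treelike (T i)"
    and p: "\<And>i. i < 3 \<Longrightarrow> P \<inter> T i = {p i}" and l: "\<And>i. i < 3 \<Longrightarrow> L \<inter> T i = {l i}"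
    and int: "\<And>i. i < 3 \<Longrightarrow> connected (T i - P - L)"
    and q: "\<And>i. i < 3 \<Longrightarrow> q i \<in> T i - P - L"
    and dis: "\<And>i j. i < 3 \<Longrightarrow> j < 3 \<Longrightarrow> i \<noteq> j \<Longrightarrow> T i \<inter> T j = {}"
    and Z: "\<And>i j k. i < 3 \<Longrightarrow> j < 3 \<Longrightarrow> k < 3 \<Longrightarrow> i \<noteq> j \<Longrightarrow> i \<noteq> k \<Longrightarrow> j \<noteq> k \<Longrightarrow>
           connected_component (- (P \<union> L \<union> T j \<union> T k)) z (q i)"
  shows False
proof -
  have D: "T 0 \<inter> T 1 = {}" "T 0 \<inter> T 2 = {}" "T 1 \<inter> T 2 = {}"
    using dis[of 0 1] dis[of 0 2] dis[of 1 2] by auto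
  have Z0: "connected_component (- (P \<union> L \<union> T 1 \<union> T 2)) z (q 0)"
    and Z1: "connected_component (- (P \<union> L \<union> T 0 \<union> T 2)) z (q 1)"
    and Z2: "connected_component (- (P \<union> L \<union> T 0 \<union> T 1)) z (q 2)"
    using Z[of 0 1 2] Z[of 1 0 2] Z[of 2 0 1] by auto
  have z: "z \<notin> P \<union> L \<union> T 0 \<union> T 1"
    using connected_component_in[OF Z2] by simp
  let ?E = "P \<union> L \<union> T 0 \<union> T 1"
  \<comment> \<open>The set is cut into two connected parts that meet in exactly two points; by the
    dual of Janiszewski's theorem it separates the plane.\<close>
  have "treelike (P \<union> T 0 \<union> L)"
    using treelike_Un[OF treelike_Un[OF P T[of 0] p[of 0]] L, of "l 0"] l[of 0] PL
    by (auto simp: Int_Un_distrib2 Int_commute)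
  moreover have "(P \<union> T 0 \<union> L) \<inter> T 1 = {p 1, l 1}"
    using p[of 1] l[of 1] D by auto
  moreover have "\<not> connected {p 1, l 1}"
    using p[of 1] l[of 1] PL connected_finite_iff_sing[of "{p 1, l 1}"] by (auto simp: doubleton_eq_iff)
  ultimately have "\<not> connected (- (P \<union> T 0 \<union> L \<union> T 1))"
    using Janiszewski_dual[of "P \<union> T 0 \<union> L" "T 1"] T[of 1] by (auto simp: treelike_def)
  then have "\<not> connected (- ?E)" by (simp add: Un_ac)
  then obtain x y where xy: "x \<in> - ?E" "y \<in> - ?E" "\<not> connected_component (- ?E) x y"
    unfolding connected_iff_connected_component by blast
  then have "\<not> connected_component (- ?E) z x \<or> \<not> connected_component (- ?E) z y"
    by (meson connected_component_sym connected_component_trans)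
  then obtain v where v: "v \<notin> ?E" "\<not> connected_component (- ?E) z v"
    using xy by blast
  have T2z: "connected_component (- ?E) z y" if "y \<in> T 2 - P - L" for y
  proof -
    have "connected_component (- ?E) (q 2) y"
      unfolding connected_component_def using int[of 2] q[of 2] that D by (intro exI[of _ "T 2 - P - L"]) auto
    then show ?thesis using Z2 connected_component_trans by metis
  qed
  have c1: "connected_component (- (P \<union> L \<union> T 0 \<union> T 2)) v (q 1)"
    by (rule theta_component_reaches[where z = z and S = "T 0" and T = "T 1"])
      (use P L T[of 0] T[of 1] int[of 1] p[of 0] l[of 0] PL D T2z v z q[of 1] in \<open>auto simp: treelike_def\<close>)
  have E': "P \<union> L \<union> T 1 \<union> T 0 = ?E" by auto
  have c0: "connected_component (- (P \<union> L \<union> T 1 \<union> T 2)) v (q 0)"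
    by (rule theta_component_reaches[where P = P and L = L and z = z and S = "T 1" and T = "T 0", unfolded E'])
      (use P L T[of 0] T[of 1] int[of 0] p[of 1] l[of 1] PL D T2z v z q[of 0] in
        \<open>auto simp: treelike_def\<close>)
  \<comment> \<open>The two obstacles share the connected set
    \<open>P \<union> T 2 \<union> L\<close>. The first is bypassed through \<open>q 1\<close>, the
    second through \<open>q 0\<close>.\<close>
  have "connected_component (- ((P \<union> L \<union> T 0 \<union> T 2) \<union> (P \<union> L \<union> T 1 \<union> T 2))) v z"
  proof (rule Janiszewski)
    have "connected (P \<union> T 2 \<union> L)"
      using treelike_Un[OF treelike_Un[OF P T[of 2] p[of 2]] L, of "l 2"] l[of 2] PL
      by (auto simp: Int_Un_distrib2 Int_commute treelike_def)
    moreover have "(P \<union> L \<union> T 0 \<union> T 2) \<inter> (P \<union> L \<union> T 1 \<union> T 2) = P \<union> T 2 \<union> L"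
      using D by auto
    ultimately show "connected ((P \<union> L \<union> T 0 \<union> T 2) \<inter> (P \<union> L \<union> T 1 \<union> T 2))" by simp
  qed (use P L T[of 0] T[of 1] T[of 2] c0 c1 Z0 Z1 in
      \<open>auto simp: treelike_def compact_imp_closed intro!: closed_Un intro: connected_component_trans connected_component_sym\<close>)
  then have "connected_component (- ?E) v z"
    by (rule connected_component_of_subset) auto
  then show False using v connected_component_sym by metis
qed

text \<open>The sets \<open>D i\<close> and \<open>U i\<close> may overlap in many points and
  \<open>Z i\<close> may meet its own arm. So each arm is thinned to a tripod \<open>T\<close> with
  ends in \<open>P\<close>, in \<open>L\<close> and at \<open>q i\<close>, and \<open>P\<close> and
  \<open>L\<close> are thinned to non-separating subsets, which reduces the claim to
  \<open>no_theta_with_apex\<close>.\<close>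

lemma no_K33:
  fixes P L :: "complex set" and D U Z :: "nat \<Rightarrow> complex set"
  assumes P: "compact P" "path_connected P" and L: "compact L" "path_connected L" and PL: "P \<inter> L = {}"
    and D: "\<And>i. i < 3 \<Longrightarrow> path_connected (D i)" "\<And>i. i < 3 \<Longrightarrow> D i \<inter> P \<noteq> {}" "\<And>i. i < 3 \<Longrightarrow> D i \<inter> L = {}"
    and U: "\<And>i. i < 3 \<Longrightarrow> path_connected (U i)" "\<And>i. i < 3 \<Longrightarrow> U i \<inter> L \<noteq> {}" "\<And>i. i < 3 \<Longrightarrow> U i \<inter> P = {}"
    and q: "\<And>i. i < 3 \<Longrightarrow> q i \<in> D i \<inter> U i"
    and dis: "\<And>i j. i < 3 \<Longrightarrow> j < 3 \<Longrightarrow> i \<noteq> j \<Longrightarrow> (D i \<union> U i) \<inter> (D j \<union> U j) = {}"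
    and Z: "\<And>i. i < 3 \<Longrightarrow> connected (Z i)" "\<And>i. i < 3 \<Longrightarrow> z \<in> Z i" "\<And>i. i < 3 \<Longrightarrow> q i \<in> Z i"
      "\<And>i. i < 3 \<Longrightarrow> Z i \<inter> (P \<union> L) = {}"
      "\<And>i j. i < 3 \<Longrightarrow> j < 3 \<Longrightarrow> i \<noteq> j \<Longrightarrow> Z i \<inter> (D j \<union> U j) = {}"
  shows False
proof -
  have ex: "\<exists>T p l. treelike T \<and> T \<subseteq> D i \<union> U i \<and> P \<inter> T = {p} \<and> L \<inter> T = {l} \<and>
     connected (T - {p} - {l}) \<and> q i \<in> T - P - L" if i: "i < 3" for i
  proof -
    have qi: "q i \<in> D i" "q i \<in> U i" "q i \<notin> P" "q i \<notin> L"
      using q[OF i] D(3)[OF i] U(3)[OF i] by auto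
    obtain d where d: "arc d" "path_image d \<subseteq> D i" "pathstart d = q i" "path_image d \<inter> P = {pathfinish d}"
      using arc_to_closed_set[of "D i" P "q i"] D[OF i] P qi by (auto simp: compact_imp_closed)
    obtain u where u: "arc u" "path_image u \<subseteq> U i" "pathstart u = q i" "path_image u \<inter> L = {pathfinish u}"
      using arc_to_closed_set[of "U i" L "q i"] U[OF i] L qi by (auto simp: compact_imp_closed)
    have qd: "q i \<in> path_image d" "q i \<in> path_image u"
      using d(3) u(3) pathstart_in_path_image by metis+
    have fu: "pathfinish u \<in> L" "pathfinish u \<in> path_image u" using u(4) by auto
    have fd: "pathfinish d \<in> P" "pathfinish d \<in> path_image d" using d(4) by auto
    \<comment> \<open>The arc \<open>u\<close> may cross \<open>d\<close> several times. Following
      it backwards from \<open>L\<close> to its first point on \<open>d\<close> leaves an arc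
      \<open>w\<close> meeting \<open>d\<close> once; \<open>q i\<close> survives as the start of
      \<open>d\<close>.\<close>
    have "pathfinish u \<notin> path_image d" using fu d(2) D(3)[OF i] by auto
    then obtain w where w: "arc w" "path_image w \<subseteq> path_image u" "pathstart w = pathfinish u"
      "path_image w \<inter> path_image d = {pathfinish w}"
      using arc_to_closed_set[of "path_image u" "path_image d" "pathfinish u"] u(1) d(1) qd fu
      by (auto simp: closed_arc_image path_connected_path_image arc_imp_path)
    let ?T = "path_image d \<union> path_image w"
    have h: "pathfinish w \<in> path_image d" "pathfinish w \<in> path_image w" using w(4) by auto
    have "treelike ?T" using treelike_Un[OF treelike_arc[OF d(1)] treelike_arc[OF w(1)]] w(4) by (simp add: Int_commute)
    moreover have "?T \<subseteq> D i \<union> U i" using d w u by auto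
    moreover have "P \<inter> ?T = {pathfinish d}" using d(4) w(2) u(2) U(3)[OF i] by auto
    moreover have "L \<inter> ?T = {pathfinish u}"
      using u(4) w(2,3) d(2) D(3)[OF i] pathstart_in_path_image[of w] by auto
    moreover have "q i \<in> ?T - P - L" using qi qd by auto
    moreover have "connected (?T - {pathfinish d} - {pathfinish u})"
    proof -
      have "pathfinish u \<in> L - D i" "pathfinish d \<in> P - U i"
        using fd fu d(2) u(2) D(3)[OF i] U(3)[OF i] by auto
      have "pathfinish w \<in> D i \<inter> U i"
        using h d(2) w(2) u(2) by auto
      have "connected (path_image w - {pathfinish u})"
        using arc_minus_pathfinish(2)[of "reversepath w"] w(1,3) by (simp add: arc_reversepath)
      moreover have "pathfinish w \<noteq> pathfinish d" "pathfinish w \<noteq> pathfinish u"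
        using \<open>pathfinish u \<in> L - D i\<close> \<open>pathfinish d \<in> P - U i\<close> \<open>pathfinish w \<in> D i \<inter> U i\<close> by auto
      ultimately have "connected ((path_image d - {pathfinish d}) \<union> (path_image w - {pathfinish u}))"
        using arc_minus_pathfinish(2)[OF d(1)] h by (intro connected_Un) auto
      moreover have "(path_image d - {pathfinish d}) \<union> (path_image w - {pathfinish u}) =
          ?T - {pathfinish d} - {pathfinish u}"
        using fd fu d(2) w(2) u(2) D(3)[OF i] U(3)[OF i] by auto
      ultimately show ?thesis by simp
    qed
    ultimately show ?thesis by blast
  qed
  then have "\<forall>i. \<exists>T p l. i < 3 \<longrightarrow> treelike T \<and> T \<subseteq> D i \<union> U i \<and> P \<inter> T = {p} \<and> L \<inter> T = {l} \<and>
     connected (T - {p} - {l}) \<and> q i \<in> T - P - L"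
    by blast
  then obtain T p l where "\<And>i. i < 3 \<longrightarrow> treelike (T i) \<and> T i \<subseteq> D i \<union> U i \<and> P \<inter> T i = {p i} \<and>
     L \<inter> T i = {l i} \<and> connected (T i - {p i} - {l i}) \<and> q i \<in> T i - P - L"
    unfolding choice_iff by blast
  then have T: "\<And>i. i < 3 \<Longrightarrow> treelike (T i)" "\<And>i. i < 3 \<Longrightarrow> T i \<subseteq> D i \<union> U i"
    "\<And>i. i < 3 \<Longrightarrow> P \<inter> T i = {p i}" "\<And>i. i < 3 \<Longrightarrow> L \<inter> T i = {l i}"
    "\<And>i. i < 3 \<Longrightarrow> connected (T i - {p i} - {l i})" "\<And>i. i < 3 \<Longrightarrow> q i \<in> T i - P - L"
    by blast+
  have pP: "p i \<in> P" "l i \<in> L" if "i < 3" for i using T(3,4)[OF that] by auto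
  \<comment> \<open>Shrinking \<open>P\<close> and \<open>L\<close> keeps the attaching points,
    hence the intersections with the arms, and adds no obstacle for \<open>Z i\<close>.\<close>
  obtain P' where P': "treelike P'" "P' \<subseteq> P" "p 0 \<in> P'" "p 1 \<in> P'" "p 2 \<in> P'"
    using treelike_three_points[OF P(2), of "p 0" "p 1" "p 2"] pP by auto
  obtain L' where L': "treelike L'" "L' \<subseteq> L" "l 0 \<in> L'" "l 1 \<in> L'" "l 2 \<in> L'"
    using treelike_three_points[OF L(2), of "l 0" "l 1" "l 2"] pP by auto
  have less3: "i = 0 \<or> i = 1 \<or> i = 2" if "i < 3" for i :: nat using that by auto
  have p': "P' \<inter> T i = {p i}" if "i < 3" for i
    using T(3)[OF that] P' less3[OF that] by auto
  have l': "L' \<inter> T i = {l i}" if "i < 3" for i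
    using T(4)[OF that] L' less3[OF that] by auto
  show False
  proof (rule no_theta_with_apex[of P' L' T p l q z])
    fix i j k :: nat assume ijk: "i < 3" "j < 3" "k < 3" "i \<noteq> j" "i \<noteq> k" "j \<noteq> k"
    have "Z i \<subseteq> - (P' \<union> L' \<union> T j \<union> T k)"
      using Z(4)[of i] Z(5)[of i j] Z(5)[of i k] T(2)[of j] T(2)[of k] P'(2) L'(2) ijk by blast
    then show "connected_component (- (P' \<union> L' \<union> T j \<union> T k)) z (q i)"
      unfolding connected_component_def using Z[of i] ijk by blast
  next
    fix i :: nat assume i: "i < 3"
    have "T i - P' - L' = T i - {p i} - {l i}" using p'[OF i] l'[OF i] by auto
    then show "connected (T i - P' - L')" using T(5)[OF i] by simp
  next
    fix i j :: nat assume "i < 3" "j < 3" "i \<noteq> j"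
    then show "T i \<inter> T j = {}" using dis[of i j] T(2)[of i] T(2)[of j] by blast
  qed (use P' L' T PL p' l' in auto)
qed

section \<open>Lipschitz paths\<close>

text \<open>A Lipschitz bound instead of unit speed makes \<open>l\<close> an upper bound for the
  length, and restriction, reversal and concatenation stay in the class without
  reparametrisation.\<close>

definition lip_path :: "('a \<Rightarrow> 'a \<Rightarrow> real) \<Rightarrow> ('a \<Rightarrow> complex) \<Rightarrow> 'a set \<Rightarrow> (real \<Rightarrow> 'a) \<Rightarrow> real \<Rightarrow> bool" where
  "lip_path d F A \<gamma> l \<longleftrightarrow> 0 \<le> l \<and> (\<forall>t\<in>{0..l}. \<gamma> t \<in> A) \<and>
     (\<forall>s\<in>{0..l}. \<forall>t\<in>{0..l}. d (\<gamma> s) (\<gamma> t) \<le> \<bar>s - t\<bar>) \<and> continuous_on {0..l} (F \<circ> \<gamma>)"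

definition linked :: "('a \<Rightarrow> 'a \<Rightarrow> real) \<Rightarrow> ('a \<Rightarrow> complex) \<Rightarrow> 'a set \<Rightarrow> 'a \<Rightarrow> 'a \<Rightarrow> real \<Rightarrow> bool" where
  "linked d F A x y l \<longleftrightarrow> (\<exists>\<gamma>. lip_path d F A \<gamma> l \<and> \<gamma> 0 = x \<and> \<gamma> l = y)"

text \<open>The inner metric of \<open>A\<close>. Between unlinked points the infimum is over the
  empty set and means nothing, so the lemmas about it carry a \<open>linked\<close>
  hypothesis.\<close>

definition dist_in :: "('a \<Rightarrow> 'a \<Rightarrow> real) \<Rightarrow> ('a \<Rightarrow> complex) \<Rightarrow> 'a set \<Rightarrow> 'a \<Rightarrow> 'a \<Rightarrow> real" where
  "dist_in d F A x y = Inf {l. linked d F A x y l}"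

lemma lip_path_subpath:
  assumes "lip_path d F A \<gamma> l" "0 \<le> a" "a \<le> b" "b \<le> l" "\<And>t. t \<in> {a..b} \<Longrightarrow> \<gamma> t \<in> A'"
  shows "lip_path d F A' (\<lambda>t. \<gamma> (a + t)) (b - a)"
proof -
  have "continuous_on {0..b - a} ((F \<circ> \<gamma>) \<circ> (\<lambda>t. a + t))"
  proof (rule continuous_on_compose)
    show "continuous_on ((\<lambda>t. a + t) ` {0..b - a}) (F \<circ> \<gamma>)"
      using assms by (auto simp: lip_path_def intro: continuous_on_subset)
  qed (auto intro!: continuous_intros)
  moreover have "\<gamma> (a + t) \<in> A'" if "0 \<le> t" "t \<le> b - a" for t
    using assms(5) that by auto
  moreover have "d (\<gamma> (a + s)) (\<gamma> (a + t)) \<le> \<bar>s - t\<bar>" if "s \<in> {0..b - a}" "t \<in> {0..b - a}" for s t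
  proof -
    have "a + s \<in> {0..l}" "a + t \<in> {0..l}" using assms(2-4) that by auto
    then have "d (\<gamma> (a + s)) (\<gamma> (a + t)) \<le> \<bar>(a + s) - (a + t)\<bar>"
      using assms(1) unfolding lip_path_def by blast
    then show ?thesis by simp
  qed
  ultimately show ?thesis using assms(3) by (auto simp: lip_path_def comp_def)
qed

lemma linked_between:
  assumes "lip_path d F A \<gamma> l" "0 \<le> a" "a \<le> b" "b \<le> l" "\<And>t. t \<in> {a..b} \<Longrightarrow> \<gamma> t \<in> A'"
  shows "linked d F A' (\<gamma> a) (\<gamma> b) (b - a)"
  using lip_path_subpath[OF assms] by (auto simp: linked_def intro!: exI[of _ "\<lambda>t. \<gamma> (a + t)"])

lemma lip_path_mono: "lip_path d F A \<gamma> l \<Longrightarrow> A \<subseteq> A' \<Longrightarrow> lip_path d F A' \<gamma> l"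
  by (auto simp: lip_path_def)

lemma linkedD: "linked d F A x y l \<Longrightarrow> x \<in> A \<and> y \<in> A \<and> 0 \<le> l \<and> d x y \<le> l"
proof -
  assume "linked d F A x y l"
  then obtain \<gamma> where \<gamma>: "0 \<le> l" "\<forall>t\<in>{0..l}. \<gamma> t \<in> A" "\<forall>s\<in>{0..l}. \<forall>t\<in>{0..l}. d (\<gamma> s) (\<gamma> t) \<le> \<bar>s - t\<bar>"
    "\<gamma> 0 = x" "\<gamma> l = y"
    by (auto simp: linked_def lip_path_def)
  then show ?thesis using \<gamma>(3)[THEN bspec, of 0, THEN bspec, of l] by auto
qed

lemma dist_in_le: "linked d F A x y l \<Longrightarrow> dist_in d F A x y \<le> l"
  unfolding dist_in_def by (intro cInf_lower bdd_belowI[of _ 0]) (auto dest: linkedD)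

lemma linked_near_dist_in:
  assumes "linked d F A x y k" "0 < \<epsilon>"
  obtains l where "l < dist_in d F A x y + \<epsilon>" "linked d F A x y l"
  using cInf_lessD[of "{l. linked d F A x y l}" "dist_in d F A x y + \<epsilon>"] assms
  by (auto simp: dist_in_def)

context Metric_space
begin

lemma linked_refl: "x \<in> A \<Longrightarrow> A \<subseteq> M \<Longrightarrow> linked d F A x x 0"
  by (auto simp: linked_def lip_path_def intro!: exI[of _ "\<lambda>_. x"])

lemma linked_sym:
  assumes "linked d F A x y l"
  shows "linked d F A y x l"
proof -
  obtain \<gamma> where \<gamma>: "lip_path d F A \<gamma> l" "\<gamma> 0 = x" "\<gamma> l = y" using assms by (auto simp: linked_def)
  have "continuous_on {0..l} ((F \<circ> \<gamma>) \<circ> (\<lambda>t. l - t))"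
  proof (rule continuous_on_compose)
    show "continuous_on ((\<lambda>t. l - t) ` {0..l}) (F \<circ> \<gamma>)"
      using \<gamma> by (auto simp: lip_path_def intro: continuous_on_subset)
  qed (auto intro!: continuous_intros)
  moreover have "d (\<gamma> (l - s)) (\<gamma> (l - t)) \<le> \<bar>s - t\<bar>" if "s \<in> {0..l}" "t \<in> {0..l}" for s t
  proof -
    have "l - s \<in> {0..l}" "l - t \<in> {0..l}" using that by auto
    then have "d (\<gamma> (l - s)) (\<gamma> (l - t)) \<le> \<bar>(l - s) - (l - t)\<bar>"
      using \<gamma>(1) unfolding lip_path_def by blast
    then show ?thesis by simp
  qed
  moreover have "\<gamma> (l - t) \<in> A" if "0 \<le> t" "t \<le> l" for t
    using \<gamma>(1) that by (auto simp: lip_path_def)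
  ultimately have "lip_path d F A (\<lambda>t. \<gamma> (l - t)) l"
    using \<gamma>(1) by (auto simp: lip_path_def comp_def)
  then show ?thesis using \<gamma> by (auto simp: linked_def intro!: exI[of _ "\<lambda>t. \<gamma> (l - t)"])
qed

lemma linked_trans:
  assumes AM: "A \<subseteq> M" and "linked d F A x y l" "linked d F A y w k"
  shows "linked d F A x w (l + k)"
proof -
  obtain \<gamma> where \<gamma>: "lip_path d F A \<gamma> l" "\<gamma> 0 = x" "\<gamma> l = y" using assms by (auto simp: linked_def)
  obtain \<eta> where \<eta>: "lip_path d F A \<eta> k" "\<eta> 0 = y" "\<eta> k = w" using assms by (auto simp: linked_def)
  define \<zeta> where "\<zeta> t = (if t \<le> l then \<gamma> t else \<eta> (t - l))" for t
  have l: "0 \<le> l" "0 \<le> k" using \<gamma> \<eta> by (auto simp: lip_path_def)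
  have in1: "\<gamma> t \<in> A" if "0 \<le> t" "t \<le> l" for t using \<gamma>(1) that by (auto simp: lip_path_def)
  have in2: "\<eta> t \<in> A" if "0 \<le> t" "t \<le> k" for t using \<eta>(1) that by (auto simp: lip_path_def)
  have lip1: "d (\<gamma> s) (\<gamma> t) \<le> \<bar>s - t\<bar>" if "0 \<le> s" "s \<le> l" "0 \<le> t" "t \<le> l" for s t
    using \<gamma>(1) that by (auto simp: lip_path_def)
  have lip2: "d (\<eta> s) (\<eta> t) \<le> \<bar>s - t\<bar>" if "0 \<le> s" "s \<le> k" "0 \<le> t" "t \<le> k" for s t
    using \<eta>(1) that by (auto simp: lip_path_def)
  have mix: "d (\<gamma> s) (\<eta> (t - l)) \<le> t - s" if "0 \<le> s" "s \<le> l" "l \<le> t" "t \<le> l + k" for s t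
  proof -
    have "d (\<gamma> s) (\<eta> (t - l)) \<le> d (\<gamma> s) y + d y (\<eta> (t - l))"
      using in1[of s] in1[of l] in2[of "t - l"] \<gamma>(3) that l AM by (intro triangle) auto
    also have "\<dots> \<le> (l - s) + (t - l)"
      using lip1[of s l] lip2[of 0 "t - l"] that l \<gamma>(3) \<eta>(2) by simp
    finally show ?thesis by simp
  qed
  have lip: "d (\<zeta> s) (\<zeta> t) \<le> \<bar>s - t\<bar>" if "s \<in> {0..l + k}" "t \<in> {0..l + k}" for s t
  proof -
    consider "s \<le> l" "t \<le> l" | "s \<le> l" "l < t" | "l < s" "t \<le> l" | "l < s" "l < t" by linarith
    then show ?thesis
    proof cases
      case 1
      then show ?thesis using lip1[of s t] that by (simp add: \<zeta>_def)
    next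
      case 2
      then show ?thesis using mix[of s t] that by (simp add: \<zeta>_def)
    next
      case 3
      then show ?thesis using mix[of t s] that by (simp add: \<zeta>_def commute)
    next
      case 4
      then show ?thesis using lip2[of "s - l" "t - l"] that by (simp add: \<zeta>_def)
    qed
  qed
  have "continuous_on ({0..l} \<union> {l..l + k}) (\<lambda>t. if t \<le> l then (F \<circ> \<gamma>) t else ((F \<circ> \<eta>) \<circ> (\<lambda>t. t - l)) t)"
  proof (rule continuous_on_cases)
    show "continuous_on {l..l + k} ((F \<circ> \<eta>) \<circ> (\<lambda>t. t - l))"
    proof (rule continuous_on_compose)
      show "continuous_on ((\<lambda>t. t - l) ` {l..l + k}) (F \<circ> \<eta>)"
        using \<eta> by (auto simp: lip_path_def intro: continuous_on_subset)
    qed (auto intro!: continuous_intros)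
  qed (use \<gamma> \<eta> in \<open>auto simp: lip_path_def\<close>)
  moreover have "{0..l} \<union> {l..l + k} = {0..l + k}" using l by auto
  moreover have "(\<lambda>t. if t \<le> l then (F \<circ> \<gamma>) t else ((F \<circ> \<eta>) \<circ> (\<lambda>t. t - l)) t) = F \<circ> \<zeta>"
    by (auto simp: \<zeta>_def)
  ultimately have "continuous_on {0..l + k} (F \<circ> \<zeta>)" by metis
  then have "lip_path d F A \<zeta> (l + k)"
    using lip l in1 in2 by (auto simp: lip_path_def \<zeta>_def)
  moreover have "\<zeta> 0 = x" "\<zeta> (l + k) = w" using l \<gamma> \<eta> by (auto simp: \<zeta>_def)
  ultimately show ?thesis by (auto simp: linked_def)
qed

lemma dist_in_lipschitz:
  assumes "A \<subseteq> M" "linked d F A p x k" "linked d F A x y l"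
  shows "dist_in d F A p y \<le> dist_in d F A p x + l"
proof -
  have "dist_in d F A p y - l \<le> dist_in d F A p x"
    unfolding dist_in_def[of d F A p x]
  proof (rule cInf_greatest)
    fix m assume "m \<in> {l. linked d F A p x l}"
    then have "linked d F A p y (m + l)" using linked_trans[OF assms(1) _ assms(3)] by simp
    then show "dist_in d F A p y - l \<le> m" using dist_in_le[of d F A p y "m + l"] by simp
  qed (use assms in auto)
  then show ?thesis by simp
qed

lemma dist_along_lip_path:
  assumes "lip_path d F A \<gamma> l" "A \<subseteq> M" "z \<in> M" "s \<in> {0..l}" "t \<in> {0..l}"
  shows "\<bar>d z (\<gamma> s) - d z (\<gamma> t)\<bar> \<le> \<bar>s - t\<bar>"
proof -
  have M: "\<gamma> s \<in> M" "\<gamma> t \<in> M" and "d (\<gamma> s) (\<gamma> t) \<le> \<bar>s - t\<bar>"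
    using assms by (auto simp: lip_path_def)
  then show ?thesis
    using triangle[OF assms(3) M] triangle[OF assms(3) M(2,1)] commute[of "\<gamma> s" "\<gamma> t"] by linarith
qed

lemma continuous_dist_lip_path:
  assumes "lip_path d F A \<gamma> l" "A \<subseteq> M" "z \<in> M"
  shows "continuous_on {0..l} (\<lambda>t. d z (\<gamma> t))"
proof -
  have "1-lipschitz_on {0..l} (\<lambda>t. d z (\<gamma> t))"
    using dist_along_lip_path[OF assms] by (auto simp: lipschitz_on_def dist_real_def)
  then show ?thesis by (rule lipschitz_on_continuous_on)
qed

text \<open>Annuli are open, so their points come arbitrarily close to the inner sphere. A single
  path is compact and keeps a positive margin, which is what \<open>leg_to_centre\<close> asks
  for.\<close>

lemma lip_path_gap:
  assumes "lip_path d F A \<gamma> l" "A \<subseteq> M" "z \<in> M" "\<And>w. w \<in> A \<Longrightarrow> \<alpha> < d z w"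
  obtains \<delta> where "0 < \<delta>" "\<And>t. t \<in> {0..l} \<Longrightarrow> \<alpha> + \<delta> \<le> d z (\<gamma> t)"
proof -
  have "{0..l} \<noteq> {}" using assms(1) by (auto simp: lip_path_def)
  then obtain t0 where t0: "t0 \<in> {0..l}" "\<And>t. t \<in> {0..l} \<Longrightarrow> d z (\<gamma> t0) \<le> d z (\<gamma> t)"
    using continuous_attains_inf[OF compact_Icc _ continuous_dist_lip_path[OF assms(1-3)]] by blast
  moreover have "\<alpha> < d z (\<gamma> t0)" using assms(1,4) t0(1) by (auto simp: lip_path_def)
  ultimately show thesis by (intro that[of "d z (\<gamma> t0) - \<alpha>"]) auto
qed

end

lemma lip_path_image:
  assumes "lip_path d F A \<gamma> l" "0 \<le> a" "b \<le> l"
  shows "compact (F ` \<gamma> ` {a..b})" "path_connected (F ` \<gamma> ` {a..b})" "connected (F ` \<gamma> ` {a..b})"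
proof -
  have c: "continuous_on {a..b} (F \<circ> \<gamma>)"
    using assms by (auto simp: lip_path_def intro: continuous_on_subset)
  show "compact (F ` \<gamma> ` {a..b})"
    using compact_continuous_image[OF c] by (simp add: image_comp)
  show "path_connected (F ` \<gamma> ` {a..b})"
    using path_connected_continuous_image[OF c] by (simp add: image_comp convex_imp_path_connected)
  then show "connected (F ` \<gamma> ` {a..b})" by (rule path_connected_imp_connected)
qed

section \<open>Level sets in thin annuli\<close>

text \<open>The slack \<open>\<epsilon>\<close> is there because a graph distance is an infimum of
  path lengths. Continuity of \<open>F\<close> is demanded along the chosen paths only, inside
  \<open>linked\<close>.\<close>

locale plane_length_space = Metric_space M d for M :: "'a set" and d +
  fixes F :: "'a \<Rightarrow> complex"
  assumes inj_F: "inj_on F M"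
    and short_path: "\<And>x y \<epsilon>. x \<in> M \<Longrightarrow> y \<in> M \<Longrightarrow> \<epsilon> > 0 \<Longrightarrow> \<exists>l \<le> d x y + \<epsilon>. linked d F M x y l"
begin

lemma disjoint_images:
  "A \<subseteq> M \<Longrightarrow> B \<subseteq> M \<Longrightarrow> A \<inter> B = {} \<Longrightarrow> F ` A \<inter> F ` B = {}"
  using inj_on_image_Int[OF inj_F] by (metis image_empty)

text \<open>An almost shortest path from \<open>z\<close> recedes from \<open>z\<close> at almost
  unit speed: at time \<open>t\<close> its distance to \<open>z\<close> is between
  \<open>t - e\<close> and \<open>t\<close>. Once it has got beyond
  \<open>\<alpha> + \<delta>\<close> it cannot fall back to \<open>\<alpha>\<close>, and little more
  than the width of the annulus remains to be travelled.\<close>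

lemma leg_to_centre:
  fixes \<beta> :: real
  assumes z: "z \<in> M" and q: "q \<in> M" "d z q < \<beta>" and \<delta>: "0 < \<delta>" "0 < \<epsilon>"
  obtains \<zeta> n where "lip_path d F M \<zeta> n" "\<zeta> 0 = z" "\<zeta> n = q"
    "\<And>t. t \<in> {0..n} \<Longrightarrow> \<alpha> + \<delta> \<le> d z (\<zeta> t) \<Longrightarrow>
       linked d F {w \<in> M. \<alpha> < d z w \<and> d z w < \<beta>} (\<zeta> t) q (n - t) \<and> n - t \<le> \<beta> - \<alpha> + \<epsilon>"
proof -
  \<comment> \<open>\<open>e < \<delta>\<close> keeps the rest of the leg outside the inner sphere,
    \<open>e < \<beta> - d z q\<close> keeps it inside the outer one, and
    \<open>e < \<epsilon>\<close> bounds its length.\<close>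
  define e where "e = min \<epsilon> (min \<delta> (\<beta> - d z q)) / 2"
  have e: "0 < e" "e < \<epsilon>" "e < \<delta>" "e < \<beta> - d z q" using assms by (auto simp: e_def min_def)
  obtain n where n: "n \<le> d z q + e" "linked d F M z q n"
    using short_path[OF z q(1) e(1)] by auto
  then obtain \<zeta> where \<zeta>: "lip_path d F M \<zeta> n" "\<zeta> 0 = z" "\<zeta> n = q"
    by (auto simp: linked_def)
  have n0: "0 \<le> n" using \<zeta>(1) by (simp add: lip_path_def)
  have up: "d z (\<zeta> t) \<le> t" if "t \<in> {0..n}" for t
    using dist_along_lip_path[OF \<zeta>(1) order_refl z that, of 0] \<zeta>(2) n0 z that mdist_zero[of z] by auto
  have lo: "t - e \<le> d z (\<zeta> t)" if "t \<in> {0..n}" for t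
    using dist_along_lip_path[OF \<zeta>(1) order_refl z that, of n] \<zeta>(3) n0 n(1) that by auto
  show thesis
  proof (rule that[OF \<zeta>])
    fix t assume t: "t \<in> {0..n}" "\<alpha> + \<delta> \<le> d z (\<zeta> t)"
    have "\<zeta> u \<in> {w \<in> M. \<alpha> < d z w \<and> d z w < \<beta>}" if u: "u \<in> {t..n}" for u
    proof (intro CollectI conjI)
      from u have u': "u \<in> {0..n}" using t by auto
      show "\<zeta> u \<in> M" using \<zeta>(1) u' by (auto simp: lip_path_def)
      show "\<alpha> < d z (\<zeta> u)" using lo[OF u'] up[OF t(1)] t(2) u e by auto
      show "d z (\<zeta> u) < \<beta>" using up[OF u'] n(1) u e by auto
    qed
    then have "linked d F {w \<in> M. \<alpha> < d z w \<and> d z w < \<beta>} (\<zeta> t) (\<zeta> n) (n - t)"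
      using linked_between[OF \<zeta>(1), of t n] t by auto
    moreover have "n - t \<le> \<beta> - \<alpha> + \<epsilon>"
      using up[OF t(1)] t(2) n(1) e \<delta> q(2) by linarith
    ultimately show "linked d F {w \<in> M. \<alpha> < d z w \<and> d z w < \<beta>} (\<zeta> t) q (n - t) \<and> n - t \<le> \<beta> - \<alpha> + \<epsilon>"
      using \<zeta>(3) by simp
  qed
qed

text \<open>Three points of the level piece that are far apart would give a drawing of the complete
  bipartite graph: the three vertices of one side are the piece, a ball around \<open>p\<close> in the inner
  metric of the annulus, and a ball around \<open>z\<close>; those of the other side are the final segments of
  almost shortest paths in the annulus from \<open>p\<close> to the three points.\<close>

lemma level_piece_diam:
  fixes \<sigma> \<alpha> \<beta> h :: real
  assumes z: "z \<in> M" and \<sigma>: "0 < \<sigma>" and \<alpha>\<beta>: "\<beta> - \<alpha> \<le> 5 * \<sigma>"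
  defines "B \<equiv> {w \<in> M. \<alpha> < d z w \<and> d z w < \<beta>}"
  assumes \<gamma>: "lip_path d F B \<gamma> l"
    and p: "\<And>t. t \<in> {0..l} \<Longrightarrow> \<exists>k. linked d F B p (\<gamma> t) k"
    and lev: "\<And>t. t \<in> {0..l} \<Longrightarrow> h \<le> dist_in d F B p (\<gamma> t) \<and> dist_in d F B p (\<gamma> t) \<le> h + 15 * \<sigma>"
  shows "d (\<gamma> 0) (\<gamma> l) \<le> 137 * \<sigma>"
proof (rule ccontr)
  assume "\<not> ?thesis"
  then have far: "137 * \<sigma> < d (\<gamma> 0) (\<gamma> l)" by simp
  define \<rho> where "\<rho> = dist_in d F B p"
  have BM: "B \<subseteq> M" by (auto simp: B_def)
  have l0: "0 \<le> l" using \<gamma> by (simp add: lip_path_def)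
  have \<gamma>B: "\<gamma> t \<in> B" if "t \<in> {0..l}" for t using \<gamma> that by (auto simp: lip_path_def)
  \<comment> \<open>The third point lies halfway, measured by distance from
    \<open>\<gamma> 0\<close>. The intermediate value theorem applies because the piece is a
    path.\<close>
  obtain \<tau> where \<tau>: "0 \<le> \<tau>" "\<tau> \<le> l" "d (\<gamma> 0) (\<gamma> \<tau>) = d (\<gamma> 0) (\<gamma> l) / 2"
  proof -
    have "\<gamma> 0 \<in> M" using \<gamma>B[of 0] l0 BM by auto
    then have "continuous_on {0..l} (\<lambda>t. d (\<gamma> 0) (\<gamma> t))"
      using continuous_dist_lip_path[OF \<gamma> BM] by blast
    moreover have "d (\<gamma> 0) (\<gamma> 0) = 0" using \<open>\<gamma> 0 \<in> M\<close> by simp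
    ultimately show thesis
      using IVT'[of "\<lambda>t. d (\<gamma> 0) (\<gamma> t)" 0 "d (\<gamma> 0) (\<gamma> l) / 2" l] l0 nonneg[of "\<gamma> 0" "\<gamma> l"] that by auto
  qed
  define T :: "nat \<Rightarrow> real" where "T i = (if i = 0 then 0 else if i = 1 then \<tau> else l)" for i
  have T: "T i \<in> {0..l}" for i using \<tau> l0 by (auto simp: T_def)
  define x where "x i = \<gamma> (T i)" for i
  have xB: "x i \<in> B" for i using \<gamma>B[OF T] by (simp add: x_def)
  have xM: "x i \<in> M" for i using xB BM by auto
  have xfar: "68 * \<sigma> < d (x i) (x j)" if "i < 3" "j < 3" "i \<noteq> j" for i j
  proof -
    have 1: "68 * \<sigma> < d (x 0) (x 1)" "68 * \<sigma> < d (x 0) (x 2)"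
      using far \<tau>(3) \<sigma> by (auto simp: x_def T_def)
    have "d (x 0) (x 2) \<le> d (x 0) (x 1) + d (x 1) (x 2)" using xM by (intro triangle)
    then have "68 * \<sigma> < d (x 1) (x 2)" using far \<tau>(3) \<sigma> by (simp add: x_def T_def)
    moreover have "(i = 0 \<and> j = 1) \<or> (i = 0 \<and> j = 2) \<or> (i = 1 \<and> j = 2) \<or>
      (j = 0 \<and> i = 1) \<or> (j = 0 \<and> i = 2) \<or> (j = 1 \<and> i = 2)" using that by auto
    ultimately show ?thesis using 1 commute by (elim disjE) auto
  qed
  have "\<exists>m \<eta>. m < \<rho> (x i) + \<sigma> \<and> lip_path d F B \<eta> m \<and> \<eta> 0 = p \<and> \<eta> m = x i" for i
  proof -
    obtain k where "linked d F B p (x i) k" using p[OF T] by (auto simp: x_def)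
    then obtain m where "m < \<rho> (x i) + \<sigma>" "linked d F B p (x i) m"
      using linked_near_dist_in[OF _ \<sigma>] by (metis \<rho>_def)
    then show ?thesis by (auto simp: linked_def)
  qed
  then obtain m \<eta> where \<eta>: "\<And>i. m i < \<rho> (x i) + \<sigma>" "\<And>i. lip_path d F B (\<eta> i) (m i)"
    "\<And>i. \<eta> i 0 = p" "\<And>i. \<eta> i (m i) = x i"
    by metis
  have \<rho>x: "h \<le> \<rho> (x i)" "\<rho> (x i) \<le> h + 15 * \<sigma>" for i
    using lev[OF T[of i]] by (auto simp: \<rho>_def x_def)
  have \<eta>B: "\<eta> i t \<in> B" if "t \<in> {0..m i}" for i t using \<eta>(2)[of i] that by (auto simp: lip_path_def)
  have lk1: "linked d F B p (\<eta> i t) t" if "t \<in> {0..m i}" for i t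
    using linked_between[OF \<eta>(2)[of i], of 0 t B] that \<eta>B \<eta>(3)[of i] by auto
  have lk2: "linked d F B (\<eta> i t) (x i) (m i - t)" if "t \<in> {0..m i}" for i t
    using linked_between[OF \<eta>(2)[of i], of t "m i" B] that \<eta>B \<eta>(4)[of i] by auto
  \<comment> \<open>Along \<open>\<eta> i\<close> parameter and inner distance from \<open>p\<close>
    agree up to \<open>\<sigma>\<close>, so the parameter intervals below translate into levels of
    \<open>\<rho>\<close>.\<close>
  have \<rho>\<eta>: "\<rho> (\<eta> i t) \<le> t" "t - \<sigma> \<le> \<rho> (\<eta> i t)" if "t \<in> {0..m i}" for i t
    using dist_in_le[OF lk1[OF that]] dist_in_lipschitz[OF BM lk1[OF that] lk2[OF that]] \<eta>(1)[of i]
    by (auto simp: \<rho>_def)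
  have m0: "0 \<le> m i" for i using \<eta>(2)[of i] by (simp add: lip_path_def)
  have mh: "h \<le> m i" for i using \<rho>\<eta>(1)[of "m i" i] \<eta>(4)[of i] \<rho>x(1)[of i] m0 by simp
  \<comment> \<open>Otherwise all three points would be within \<open>31 * \<sigma>\<close> of
    \<open>p\<close>. The bound makes \<open>h - 15 * \<sigma>\<close> a legal parameter on every
    \<open>\<eta> i\<close>.\<close>
  have h: "15 * \<sigma> \<le> h"
  proof (rule ccontr)
    assume "\<not> ?thesis"
    then have "m i < 31 * \<sigma>" for i using \<eta>(1)[of i] \<rho>x(2)[of i] by simp
    moreover have "d p (x i) \<le> m i" for i using linkedD[OF lk2[of 0 i]] m0[of i] \<eta>(3)[of i] by simp
    ultimately have "d p (x i) < 31 * \<sigma>" for i by (meson le_less_trans)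
    moreover have "p \<in> M" using \<eta>B[of 0 0] m0[of 0] \<eta>(3)[of 0] BM by auto
    ultimately have "d (x 0) (x 1) < 62 * \<sigma>"
      using triangle[OF xM[of 0] _ xM[of 1], of p] commute[of p "x 0"]
      by (smt (verit, best))
    then show False using xfar[of 0 1] \<sigma> by simp
  qed
  \<comment> \<open>A leg changes \<open>\<rho>\<close> by at most \<open>6 * \<sigma>\<close>
    between the drawing and \<open>q i\<close>. At \<open>7 * \<sigma>\<close> below
    \<open>h\<close> the point \<open>q i\<close> is too low for its leg to meet \<open>LX\<close>;
    having level at least \<open>h - 8 * \<sigma>\<close>, it is too high for the leg to meet
    \<open>PX\<close>, whose levels are at most \<open>h - 15 * \<sigma>\<close>.\<close>
  define q where "q i = \<eta> i (h - 7 * \<sigma>)" for i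
  define PX where "PX = (\<Union>i<3. \<eta> i ` {0..h - 15 * \<sigma>})"
  define LX where "LX = \<gamma> ` {0..l}"
  define DX where "DX i = \<eta> i ` {h - 15 * \<sigma>..h - 7 * \<sigma>}" for i
  define UX where "UX i = \<eta> i ` {h - 7 * \<sigma>..m i}" for i
  have qm: "h - 7 * \<sigma> \<in> {0..m i}" for i using h \<sigma> mh[of i] by auto
  have qB: "q i \<in> B" for i using \<eta>B[OF qm] by (simp add: q_def)
  have qlev: "\<rho> (q i) \<le> h - 7 * \<sigma>" "h - 8 * \<sigma> \<le> \<rho> (q i)" for i
    using \<rho>\<eta>[OF qm[of i]] by (auto simp: q_def)
  have Plev: "\<rho> w \<le> h - 15 * \<sigma>" if w: "w \<in> PX" for w
  proof -
    obtain i t where t: "w = \<eta> i t" "t \<in> {0..h - 15 * \<sigma>}" using w by (auto simp: PX_def)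
    then have "t \<in> {0..m i}" using mh[of i] \<sigma> by auto
    then show ?thesis using \<rho>\<eta>(1)[of t i] t by auto
  qed
  have Llev: "h \<le> \<rho> w" if "w \<in> LX" for w
    using that lev by (auto simp: LX_def \<rho>_def)
  have Dlev: "\<rho> w \<le> h - 7 * \<sigma>" if w: "w \<in> DX i" for w i
  proof -
    obtain t where t: "w = \<eta> i t" "t \<in> {h - 15 * \<sigma>..h - 7 * \<sigma>}" using w by (auto simp: DX_def)
    then have "t \<in> {0..m i}" using mh[of i] h \<sigma> by auto
    then show ?thesis using \<rho>\<eta>(1)[of t i] t by auto
  qed
  have Ulev: "h - 8 * \<sigma> \<le> \<rho> w" if w: "w \<in> UX i" for w i
  proof -
    obtain t where t: "w = \<eta> i t" "t \<in> {h - 7 * \<sigma>..m i}" using w by (auto simp: UX_def)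
    then have "t \<in> {0..m i}" using h \<sigma> by auto
    then show ?thesis using \<rho>\<eta>(2)[of t i] t by auto
  qed
  \<comment> \<open>\<open>31 = 15 + 15 + 1\<close>: the stretch below \<open>h\<close>, the spread
    of levels above \<open>h\<close>, and the slack in \<open>m i\<close>. Two such distances plus a
    leg of \<open>6 * \<sigma>\<close> give the \<open>68 * \<sigma>\<close> of
    \<open>xfar\<close>.\<close>
  have near: "d w (x i) \<le> 31 * \<sigma>" if w: "w \<in> DX i \<union> UX i" for w i
  proof -
    obtain t where t: "w = \<eta> i t" "t \<in> {h - 15 * \<sigma>..m i}"
      using w mh[of i] \<sigma> by (auto simp: DX_def UX_def)
    then have "t \<in> {0..m i}" using h by auto
    then have "d w (x i) \<le> m i - t" using linkedD[OF lk2[of t i]] t by auto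
    then show ?thesis using t(2) \<eta>(1)[of i] \<rho>x(2)[of i] by auto
  qed
  have sub: "PX \<subseteq> B" "LX \<subseteq> B" "DX i \<subseteq> B" "UX i \<subseteq> B" for i
  proof -
    show "LX \<subseteq> B" using \<gamma>B by (auto simp: LX_def)
    show "DX i \<subseteq> B" using \<eta>B[of _ i] h \<sigma> mh[of i] by (auto simp: DX_def)
    show "UX i \<subseteq> B" using \<eta>B[of _ i] h \<sigma> by (auto simp: UX_def)
    have "\<eta> j ` {0..h - 15 * \<sigma>} \<subseteq> B" for j using \<eta>B[of _ j] \<sigma> mh[of j] by auto
    then show "PX \<subseteq> B" by (auto simp: PX_def)
  qed
  \<comment> \<open>One margin for the whole drawing: the part of a leg still closer to the inner
    sphere than \<open>\<delta>\<close> cannot touch any of these sets.\<close>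
  obtain \<delta> where \<delta>: "0 < \<delta>" "\<And>w i. i < 3 \<Longrightarrow> w \<in> PX \<union> LX \<union> DX i \<union> UX i \<Longrightarrow> \<alpha> + \<delta> \<le> d z w"
  proof -
    have \<alpha>B: "\<And>w. w \<in> B \<Longrightarrow> \<alpha> < d z w" by (auto simp: B_def)
    obtain e where e: "0 < e" "\<And>t. t \<in> {0..l} \<Longrightarrow> \<alpha> + e \<le> d z (\<gamma> t)"
      using lip_path_gap[OF \<gamma> BM z \<alpha>B] by blast
    have "\<exists>e>0. \<forall>t\<in>{0..m i}. \<alpha> + e \<le> d z (\<eta> i t)" for i
      using lip_path_gap[OF \<eta>(2)[of i] BM z \<alpha>B] by metis
    then obtain E where E: "\<And>i. 0 < E i" "\<And>i t. t \<in> {0..m i} \<Longrightarrow> \<alpha> + E i \<le> d z (\<eta> i t)"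
      by metis
    define \<delta> where "\<delta> = Min (insert e (E ` {..<3}))"
    have le: "\<delta> \<le> e" "\<And>i. i < 3 \<Longrightarrow> \<delta> \<le> E i" by (auto simp: \<delta>_def)
    have a1: "\<alpha> + \<delta> \<le> d z (\<eta> i t)" if "i < 3" "t \<in> {0..m i}" for i t
      using E(2)[OF that(2)] le(2)[OF that(1)] by linarith
    have a2: "\<alpha> + \<delta> \<le> d z w" if "w \<in> LX" for w
      using e(2) le(1) that unfolding LX_def by fastforce
    have a3: "\<alpha> + \<delta> \<le> d z w" if "i < 3" "w \<in> DX i \<union> UX i" for i w
      using that a1[of i] h \<sigma> mh[of i] by (auto simp: DX_def UX_def)
    have a4: "\<alpha> + \<delta> \<le> d z w" if w: "w \<in> PX" for w
    proof -
      obtain i t where "i < 3" "w = \<eta> i t" "t \<in> {0..h - 15 * \<sigma>}" using w by (auto simp: PX_def)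
      then show ?thesis using a1[of i t] \<sigma> mh[of i] by auto
    qed
    have "0 < \<delta>" using e(1) E(1) by (auto simp: \<delta>_def)
    then show thesis using that a2 a3 a4 by blast
  qed
  have "\<exists>\<zeta> n. lip_path d F M \<zeta> n \<and> \<zeta> 0 = z \<and> \<zeta> n = q i \<and>
    (\<forall>t\<in>{0..n}. \<alpha> + \<delta> \<le> d z (\<zeta> t) \<longrightarrow> linked d F B (\<zeta> t) (q i) (n - t) \<and> n - t \<le> 6 * \<sigma>)" for i
  proof -
    have qi: "q i \<in> M" "d z (q i) < \<beta>" using qB[of i] by (auto simp: B_def)
    obtain \<zeta> n where \<zeta>: "lip_path d F M \<zeta> n" "\<zeta> 0 = z" "\<zeta> n = q i"
      "\<And>t. t \<in> {0..n} \<Longrightarrow> \<alpha> + \<delta> \<le> d z (\<zeta> t) \<Longrightarrow> linked d F B (\<zeta> t) (q i) (n - t) \<and> n - t \<le> \<beta> - \<alpha> + \<sigma>"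
      by (rule leg_to_centre[OF z qi \<delta>(1) \<sigma>, of \<alpha>, folded B_def]) blast
    have "n - t \<le> 6 * \<sigma>" if "t \<in> {0..n}" "\<alpha> + \<delta> \<le> d z (\<zeta> t)" for t
      using \<zeta>(4)[OF that] \<alpha>\<beta> by linarith
    then show ?thesis using \<zeta> by blast
  qed
  then obtain \<zeta> n where \<zeta>: "\<And>i. lip_path d F M (\<zeta> i) (n i)" "\<And>i. \<zeta> i 0 = z" "\<And>i. \<zeta> i (n i) = q i"
    "\<And>i t. t \<in> {0..n i} \<Longrightarrow> \<alpha> + \<delta> \<le> d z (\<zeta> i t) \<Longrightarrow>
       linked d F B (\<zeta> i t) (q i) (n i - t) \<and> n i - t \<le> 6 * \<sigma>"
    by metis
  define ZX where "ZX i = \<zeta> i ` {0..n i}" for i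
  have n0: "0 \<le> n i" for i using \<zeta>(1)[of i] by (simp add: lip_path_def)
  \<comment> \<open>Although a leg starts outside the annulus when \<open>z\<close> does, from any
    contact with the drawing it runs inside \<open>B\<close>, so that the contact can be measured
    with \<open>\<rho>\<close>. The bound \<open>6 * \<sigma>\<close> is the width
    \<open>5 * \<sigma>\<close> plus the slack.\<close>
  have leg: "\<exists>k \<le> 6 * \<sigma>. linked d F B w (q i) k"
    if w: "w \<in> ZX i" "j < 3" "w \<in> PX \<union> LX \<union> DX j \<union> UX j" for w i j
  proof -
    obtain t where t: "w = \<zeta> i t" "t \<in> {0..n i}" using w(1) by (auto simp: ZX_def)
    then show ?thesis using \<zeta>(4)[of t i] \<delta>(2)[OF w(2,3)] by blast
  qed
  have pq: "linked d F B p (q i) (h - 7 * \<sigma>)" for i using lk1[OF qm] by (simp add: q_def)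
  have leg\<rho>: "\<rho> (q i) \<le> \<rho> w + 6 * \<sigma>" "\<rho> w \<le> \<rho> (q i) + 6 * \<sigma>"
    if w: "w \<in> ZX i" "w \<in> PX \<union> LX" for w i
  proof -
    obtain k where k: "k \<le> 6 * \<sigma>" "linked d F B w (q i) k" using leg[of w i 0] w by auto
    have k': "linked d F B (q i) w k" using linked_sym[OF k(2)] .
    have pw: "linked d F B p w (h - 7 * \<sigma> + k)" by (rule linked_trans[OF BM pq k'])
    then show "\<rho> (q i) \<le> \<rho> w + 6 * \<sigma>" "\<rho> w \<le> \<rho> (q i) + 6 * \<sigma>"
      using dist_in_lipschitz[OF BM pw k(2)] dist_in_lipschitz[OF BM pq k'] k(1)
      unfolding \<rho>_def by linarith+
  qed
  have subM: "PX \<subseteq> M" "LX \<subseteq> M" "DX i \<subseteq> M" "UX i \<subseteq> M" "ZX i \<subseteq> M" for i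
  proof -
    show "ZX i \<subseteq> M" using \<zeta>(1)[of i] by (auto simp: lip_path_def ZX_def)
  qed (use sub BM in blast)+
  show False
  proof (rule no_K33[of "F ` PX" "F ` LX" "\<lambda>i. F ` DX i" "\<lambda>i. F ` UX i" "\<lambda>i. F (q i)" "\<lambda>i. F ` ZX i" "F z"])
    have c: "compact (F ` \<eta> i ` {0..h - 15 * \<sigma>})" "path_connected (F ` \<eta> i ` {0..h - 15 * \<sigma>})" for i
      using lip_path_image[OF \<eta>(2)[of i], of 0 "h - 15 * \<sigma>"] mh[of i] \<sigma> by auto
    have FP: "F ` PX = (\<Union>i<3. F ` \<eta> i ` {0..h - 15 * \<sigma>})" by (auto simp: PX_def)
    show "compact (F ` PX)" unfolding FP using c by (intro compact_UN) auto
    have "F p \<in> F ` \<eta> i ` {0..h - 15 * \<sigma>}" for i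
      using h \<eta>(3)[of i] by (auto intro!: image_eqI[of p "\<eta> i" 0] simp: atLeastAtMost_iff)
    then show "path_connected (F ` PX)" unfolding FP using c by (intro path_connected_UNION[of _ _ "F p"]) auto
    show "compact (F ` LX)" "path_connected (F ` LX)"
      unfolding LX_def using lip_path_image[OF \<gamma>, of 0 l] by auto
    have False if "w \<in> PX" "w \<in> LX" for w
      using Plev[OF that(1)] Llev[OF that(2)] \<sigma> by linarith
    then have "PX \<inter> LX = {}" by blast
    then show "F ` PX \<inter> F ` LX = {}" by (rule disjoint_images[OF subM(1) subM(2)])
    fix i :: nat assume i: "i < 3"
    show "path_connected (F ` DX i)"
      unfolding DX_def using lip_path_image(2)[OF \<eta>(2)[of i], of "h - 15 * \<sigma>" "h - 7 * \<sigma>"] h \<sigma> mh[of i] by auto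
    have "\<eta> i (h - 15 * \<sigma>) \<in> DX i \<inter> PX"
      using i h \<sigma> by (auto simp: DX_def PX_def atLeastAtMost_iff intro!: bexI[of _ i])
    then show "F ` DX i \<inter> F ` PX \<noteq> {}" by blast
    have False if "w \<in> DX i" "w \<in> LX" for w
      using Dlev[OF that(1)] Llev[OF that(2)] \<sigma> by linarith
    then have "DX i \<inter> LX = {}" by blast
    then show "F ` DX i \<inter> F ` LX = {}" by (rule disjoint_images[OF subM(3) subM(2)])
    show "path_connected (F ` UX i)"
      unfolding UX_def using lip_path_image(2)[OF \<eta>(2)[of i], of "h - 7 * \<sigma>" "m i"] h \<sigma> by auto
    have "x i \<in> UX i" using \<eta>(4)[of i] mh[of i] \<sigma>
      by (auto simp: UX_def atLeastAtMost_iff intro!: image_eqI[of _ _ "m i"])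
    moreover have "x i \<in> LX" using T by (auto simp: x_def LX_def)
    ultimately show "F ` UX i \<inter> F ` LX \<noteq> {}" by blast
    have False if "w \<in> UX i" "w \<in> PX" for w
      using Ulev[OF that(1)] Plev[OF that(2)] \<sigma> by linarith
    then have "UX i \<inter> PX = {}" by blast
    then show "F ` UX i \<inter> F ` PX = {}" by (rule disjoint_images[OF subM(4) subM(1)])
    have "q i \<in> DX i \<inter> UX i"
      using qm[of i] h \<sigma> by (auto simp: q_def DX_def UX_def atLeastAtMost_iff)
    then show "F (q i) \<in> F ` DX i \<inter> F ` UX i" by blast
    show "connected (F ` ZX i)" unfolding ZX_def using lip_path_image(3)[OF \<zeta>(1)[of i], of 0 "n i"] by auto
    have "z \<in> ZX i" "q i \<in> ZX i"
      using \<zeta>(2,3)[of i] n0[of i] by (force simp: ZX_def atLeastAtMost_iff)+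
    then show "F z \<in> F ` ZX i" "F (q i) \<in> F ` ZX i" by blast+
    have "ZX i \<inter> (PX \<union> LX) = {}"
    proof (rule ccontr)
      assume "\<not> ?thesis"
      then obtain w where w: "w \<in> ZX i" "w \<in> PX \<union> LX" by blast
      show False
      proof (cases "w \<in> PX")
        case True
        then show False using Plev[OF True] leg\<rho>(1)[OF w] qlev(2)[of i] \<sigma> by linarith
      next
        case False
        then have "h \<le> \<rho> w" using w Llev by blast
        then show False using leg\<rho>(2)[OF w] qlev(1)[of i] \<sigma> by linarith
      qed
    qed
    then show "F ` ZX i \<inter> (F ` PX \<union> F ` LX) = {}"
      using disjoint_images[of "ZX i" "PX \<union> LX"] subM by (simp add: image_Un)
    fix j :: nat assume j: "j < 3" "i \<noteq> j"
    have "(DX i \<union> UX i) \<inter> (DX j \<union> UX j) = {}"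
    proof (rule ccontr)
      assume "\<not> ?thesis"
      then obtain w where w: "w \<in> DX i \<union> UX i" "w \<in> DX j \<union> UX j" by blast
      then have "w \<in> M" using subM by blast
      then have "d (x i) (x j) \<le> d w (x i) + d w (x j)"
        using triangle[OF xM _ xM, of w i j] commute[of w "x i"] by simp
      then show False using near[OF w(1)] near[OF w(2)] xfar[OF i j] \<sigma> by linarith
    qed
    then show "(F ` DX i \<union> F ` UX i) \<inter> (F ` DX j \<union> F ` UX j) = {}"
      using disjoint_images[of "DX i \<union> UX i" "DX j \<union> UX j"] subM by (simp add: image_Un)
    have "ZX i \<inter> (DX j \<union> UX j) = {}"
    proof (rule ccontr)
      assume "\<not> ?thesis"
      then obtain w where w: "w \<in> ZX i" "w \<in> DX j \<union> UX j" by blast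
      then obtain k where k: "k \<le> 6 * \<sigma>" "linked d F B w (q i) k" using leg[of w i j] j by auto
      have qi: "q i \<in> DX i \<union> UX i"
        using qm[of i] h \<sigma> by (auto simp: q_def DX_def UX_def atLeastAtMost_iff)
      have "w \<in> M" "q i \<in> M" using w qB[of i] BM subM by blast+
      then have "d (x i) (x j) \<le> d (q i) (x i) + d w (q i) + d w (x j)"
        using triangle[OF xM[of i] _ xM[of j], of w] triangle[OF _ _ xM[of i], of w "q i"]
          commute[of w "x i"] by auto
      then show False
        using near[OF w(2)] near[OF qi] xfar[OF i j] linkedD[OF k(2)] k(1) \<sigma> by linarith
    qed
    then show "F ` ZX i \<inter> (F ` DX j \<union> F ` UX j) = {}"
      using disjoint_images[of "ZX i" "DX j \<union> UX j"] subM by (simp add: image_Un)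
  qed
qed

end

section \<open>Two-coloured coverings of thin annuli\<close>

lemma floor_interval:
  fixes x N :: real
  assumes "0 < N"
  shows "of_int \<lfloor>x / N\<rfloor> * N \<le> x" "x < (of_int \<lfloor>x / N\<rfloor> + 1) * N"
  using assms by (simp_all add: floor_divide_lower floor_divide_upper)

context plane_length_space
begin

text \<open>A one-dimensional Nagata covering in coloured form. The last clause is a Lebesgue number
  rather than mere covering: it lets a small piece at one scale be placed inside a single piece at a
  larger scale.\<close>

definition two_colouring :: "'a set \<Rightarrow> real \<Rightarrow> (bool \<Rightarrow> 'a set set) \<Rightarrow> bool" where
  "two_colouring A \<sigma> \<U> \<longleftrightarrow>
     (\<forall>c. \<forall>U\<in>\<U> c. U \<subseteq> A \<and> (\<forall>x\<in>U. \<forall>y\<in>U. d x y \<le> 137 * \<sigma>)) \<and>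
     (\<forall>c. \<forall>U\<in>\<U> c. \<forall>V\<in>\<U> c. U \<noteq> V \<longrightarrow> (\<forall>x\<in>U. \<forall>y\<in>V. \<sigma> < d x y)) \<and>
     (\<forall>S. S \<subseteq> A \<and> S \<noteq> {} \<and> (\<forall>x\<in>S. \<forall>y\<in>S. d x y \<le> \<sigma>) \<longrightarrow> (\<exists>c. \<exists>U\<in>\<U> c. S \<subseteq> U))"

text \<open>In each path component of a slightly wider annulus, bands of the inner distance to a
  base point are cut into linked pieces and coloured by the parity of the band.
  \<open>level_piece_diam\<close> bounds the pieces; bands of equal parity are too far apart in
  level to come close.\<close>

lemma ex_two_colouring:
  assumes z: "z \<in> M" and \<sigma>: "0 < \<sigma>" and ab: "b - a \<le> \<sigma>"
  defines "A \<equiv> {x \<in> M. a \<le> d z x \<and> d z x \<le> b}"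
  shows "\<exists>\<U>. two_colouring A \<sigma> \<U>"
proof -
  define B where "B = {w \<in> M. a - 2 * \<sigma> < d z w \<and> d z w < b + 2 * \<sigma>}"
  have BM: "B \<subseteq> M" by (auto simp: B_def)
  have AB: "A \<subseteq> B" using \<sigma> by (auto simp: A_def B_def)
  \<comment> \<open>Linked points have the same set of candidates, so the choice is constant on
    components.\<close>
  define base where "base x = (SOME p. \<exists>l. linked d F B x p l)" for x
  define g where "g x = dist_in d F B (base x) x" for x
  have base_linked: "\<exists>l. linked d F B (base x) x l" if "x \<in> B" for x
  proof -
    have "\<exists>p l. linked d F B x p l" using linked_refl[OF that BM] by blast
    then have "\<exists>l. linked d F B x (base x) l" unfolding base_def by (rule someI_ex)
    then show ?thesis using linked_sym by blast
  qed
  have base_eq: "base x = base y" if "linked d F B x y l" for x y l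
  proof -
    have "(\<lambda>p. \<exists>l. linked d F B x p l) = (\<lambda>p. \<exists>l. linked d F B y p l)"
      using linked_trans[OF BM that] linked_trans[OF BM linked_sym[OF that]] by blast
    then show ?thesis by (simp add: base_def)
  qed
  have g_lip: "\<bar>g x - g y\<bar> \<le> l" if xy: "linked d F B x y l" for x y l
  proof -
    have yx: "linked d F B y x l" by (rule linked_sym[OF xy])
    have "x \<in> B" "y \<in> B" using linkedD[OF xy] by auto
    then obtain k m where k: "linked d F B (base x) x k" and m: "linked d F B (base x) y m"
      using base_linked base_eq[OF xy] by metis
    have "g y \<le> g x + l" using dist_in_lipschitz[OF BM k xy] base_eq[OF xy] by (simp add: g_def)
    moreover have "g x \<le> g y + l" using dist_in_lipschitz[OF BM m yx] base_eq[OF xy] by (simp add: g_def)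
    ultimately show ?thesis by linarith
  qed
  \<comment> \<open>A path of length at most \<open>2 * \<sigma>\<close> changes its distance to
    \<open>z\<close> by at most \<open>\<sigma>\<close> from one of its ends, so it remains within
    the margin \<open>2 * \<sigma>\<close> of \<open>B\<close>.\<close>
  have near: "\<exists>\<gamma> l. lip_path d F B \<gamma> l \<and> l \<le> 2 * \<sigma> \<and> \<gamma> 0 = x \<and> \<gamma> l = y"
    if xy: "x \<in> A" "y \<in> A" "d x y \<le> \<sigma>" for x y
  proof -
    have M: "x \<in> M" "y \<in> M" using xy by (auto simp: A_def)
    obtain l where "l \<le> d x y + \<sigma>" "linked d F M x y l"
      using short_path[OF M \<sigma>] by blast
    then have l: "l \<le> 2 * \<sigma>" "linked d F M x y l" using xy(3) by auto
    then obtain \<gamma> where \<gamma>: "lip_path d F M \<gamma> l" "\<gamma> 0 = x" "\<gamma> l = y" by (auto simp: linked_def)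
    have l0: "0 \<le> l" using \<gamma> by (simp add: lip_path_def)
    have "\<gamma> t \<in> B" if t: "t \<in> {0..l}" for t
    proof -
      have "\<gamma> t \<in> M" using \<gamma>(1) t by (auto simp: lip_path_def)
      moreover have "\<bar>d z (\<gamma> t) - d z x\<bar> \<le> t" "\<bar>d z (\<gamma> t) - d z y\<bar> \<le> l - t"
        using dist_along_lip_path[OF \<gamma>(1) order_refl z t, of 0] dist_along_lip_path[OF \<gamma>(1) order_refl z t, of l]
          \<gamma>(2,3) t l0 by auto
      moreover have "a \<le> d z x" "d z x \<le> b" "a \<le> d z y" "d z y \<le> b" using xy by (auto simp: A_def)
      ultimately show ?thesis using l(1) \<sigma> by (auto simp: B_def)
    qed
    then have "lip_path d F B \<gamma> l" using \<gamma>(1) by (auto simp: lip_path_def)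
    then show ?thesis using l \<gamma> by blast
  qed
  \<comment> \<open>Levels in \<open>G k\<close> and \<open>G (k + 2)\<close> differ by at least
    \<open>N - 4 * \<sigma> = 3 * \<sigma>\<close>, but by at most \<open>2 * \<sigma>\<close> for
    points at distance \<open>\<sigma>\<close>. The width of \<open>S k\<close> is
    \<open>7 + 2 * 4 = 15\<close> units, as in \<open>level_piece_diam\<close>.\<close>
  define N where "N = 7 * \<sigma>"
  \<comment> \<open>The first margin of \<open>2 * \<sigma>\<close> captures every set of diameter
    \<open>\<sigma>\<close> that meets the core band; the second one, in \<open>S k\<close>,
    captures the paths joining its points. Hence links are taken in \<open>S k\<close>, while only
    points of \<open>G k\<close> are collected.\<close>
  define G where "G k = {x \<in> A. of_int k * N - 2 * \<sigma> \<le> g x \<and> g x \<le> (of_int k + 1) * N + 2 * \<sigma>}" for k :: int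
  define S where "S k = {x \<in> B. of_int k * N - 4 * \<sigma> \<le> g x \<and> g x \<le> (of_int k + 1) * N + 4 * \<sigma>}" for k :: int
  have SB: "S k \<subseteq> B" and SM: "S k \<subseteq> M" and GS: "G k \<subseteq> S k" for k
    using BM AB \<sigma> by (auto simp: S_def G_def)
  define piece where "piece k x = {y \<in> G k. \<exists>l. linked d F (S k) x y l}" for k x
  have near_S: "\<exists>l. linked d F (S k) x y l" and near_g: "\<bar>g x - g y\<bar> \<le> 2 * \<sigma>"
    if xy: "x \<in> A" "y \<in> A" "d x y \<le> \<sigma>" and x: "x \<in> G k" for x y k
  proof -
    obtain \<gamma> l where \<gamma>: "lip_path d F B \<gamma> l" "l \<le> 2 * \<sigma>" "\<gamma> 0 = x" "\<gamma> l = y" using near[OF xy] by blast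
    have l0: "0 \<le> l" using \<gamma> by (simp add: lip_path_def)
    have gt: "\<bar>g x - g (\<gamma> t)\<bar> \<le> 2 * \<sigma>" if t: "t \<in> {0..l}" for t
    proof -
      have "linked d F B (\<gamma> 0) (\<gamma> t) (t - 0)"
        by (rule linked_between[OF \<gamma>(1)]) (use t \<gamma>(1) in \<open>auto simp: lip_path_def\<close>)
      then show ?thesis using g_lip[of x "\<gamma> t" t] \<gamma>(2,3) t by auto
    qed
    show "\<bar>g x - g y\<bar> \<le> 2 * \<sigma>" using gt[of l] l0 \<gamma>(4) by simp
    have "\<gamma> t \<in> S k" if t: "t \<in> {0..l}" for t
      using gt[OF t] x \<gamma>(1) t by (auto simp: S_def G_def lip_path_def)
    then have "lip_path d F (S k) \<gamma> l" using \<gamma>(1) by (auto simp: lip_path_def)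
    then show "\<exists>l. linked d F (S k) x y l" using \<gamma> by (auto simp: linked_def)
  qed
  have piece_linked: "\<exists>l. linked d F (S k) y y' l" if "y \<in> piece k x" "y' \<in> piece k x" for k x y y'
    using that linked_trans[OF SM linked_sym] by (fastforce simp: piece_def)
  have piece_eq: "piece k x = piece k x'" if xx: "linked d F (S k) x x' l" for k x x' l
    unfolding piece_def using linked_trans[OF SM xx] linked_trans[OF SM linked_sym[OF xx]] by blast
  define \<U> where "\<U> c = {piece k x |k x. x \<in> G k \<and> even k = c}" for c
  show ?thesis
    unfolding two_colouring_def
  proof (intro exI[of _ \<U>] conjI allI ballI impI)
    fix c U assume "U \<in> \<U> c"
    then show "U \<subseteq> A" by (auto simp: \<U>_def piece_def G_def)
  next
    fix c U x y assume U: "U \<in> \<U> c" "x \<in> U" "y \<in> U"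
    then obtain k w where "U = piece k w" by (auto simp: \<U>_def)
    then obtain l where "linked d F (S k) x y l" using piece_linked U by blast
    then obtain \<gamma> where \<gamma>: "lip_path d F (S k) \<gamma> l" "\<gamma> 0 = x" "\<gamma> l = y" by (auto simp: linked_def)
    have \<gamma>B: "lip_path d F B \<gamma> l" by (rule lip_path_mono[OF \<gamma>(1) SB])
    have base: "base (\<gamma> t) = base x" "\<gamma> t \<in> S k" if t: "t \<in> {0..l}" for t
    proof -
      have "linked d F B (\<gamma> 0) (\<gamma> t) (t - 0)"
        by (rule linked_between[OF \<gamma>B]) (use t \<gamma>B in \<open>auto simp: lip_path_def\<close>)
      then show "base (\<gamma> t) = base x" using base_eq \<gamma>(2) by metis
      show "\<gamma> t \<in> S k" using \<gamma>(1) t by (auto simp: lip_path_def)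
    qed
    have "d (\<gamma> 0) (\<gamma> l) \<le> 137 * \<sigma>"
    proof (rule level_piece_diam[OF z \<sigma>, where \<alpha> = "a - 2 * \<sigma>" and \<beta> = "b + 2 * \<sigma>" and p = "base x"
          and h = "of_int k * N - 4 * \<sigma>", folded B_def])
      show "b + 2 * \<sigma> - (a - 2 * \<sigma>) \<le> 5 * \<sigma>" using ab by simp
      show "lip_path d F B \<gamma> l" by (rule \<gamma>B)
      fix t assume t: "t \<in> {0..l}"
      show "\<exists>k. linked d F B (base x) (\<gamma> t) k"
        using base_linked[of "\<gamma> t"] base[OF t] SB by auto
      have "dist_in d F B (base x) (\<gamma> t) = g (\<gamma> t)" using base[OF t] by (simp add: g_def)
      then show "of_int k * N - 4 * \<sigma> \<le> dist_in d F B (base x) (\<gamma> t) \<and>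
          dist_in d F B (base x) (\<gamma> t) \<le> of_int k * N - 4 * \<sigma> + 15 * \<sigma>"
        using base(2)[OF t] by (simp add: S_def N_def algebra_simps)
    qed
    then show "d x y \<le> 137 * \<sigma>" using \<gamma> by simp
  next
    fix c U V x y assume UV: "U \<in> \<U> c" "V \<in> \<U> c" "U \<noteq> V" "x \<in> U" "y \<in> V"
    obtain k u where U: "U = piece k u" "even k = c" using UV(1) by (auto simp: \<U>_def)
    obtain m v where V: "V = piece m v" "even m = c" using UV(2) by (auto simp: \<U>_def)
    have xG: "x \<in> G k" "x \<in> A" and yG: "y \<in> G m" "y \<in> A" using U V UV by (auto simp: piece_def G_def)
    show "\<sigma> < d x y"
    proof (rule ccontr)
      assume "\<not> ?thesis"
      then have dxy: "d x y \<le> \<sigma>" by simp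
      have gxy: "\<bar>g x - g y\<bar> \<le> 2 * \<sigma>" by (rule near_g[OF xG(2) yG(2) dxy xG(1)])
      have "k = m"
      proof (rule ccontr)
        assume "k \<noteq> m"
        moreover have "even k = even m" using U(2) V(2) by simp
        ultimately have "k + 2 \<le> m \<or> m + 2 \<le> k" by presburger
        then show False
        proof
          assume "k + 2 \<le> m"
          then have "(of_int k + 2) * N \<le> of_int m * N" using \<sigma> by (intro mult_right_mono) (auto simp: N_def)
          then show False using xG(1) yG(1) gxy \<sigma> by (simp add: G_def N_def algebra_simps)
        next
          assume "m + 2 \<le> k"
          then have "(of_int m + 2) * N \<le> of_int k * N" using \<sigma> by (intro mult_right_mono) (auto simp: N_def)
          then show False using xG(1) yG(1) gxy \<sigma> by (simp add: G_def N_def algebra_simps)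
        qed
      qed
      obtain l where xy: "linked d F (S k) x y l" using near_S[OF xG(2) yG(2) dxy xG(1)] by blast
      obtain l1 l2 where l1: "linked d F (S k) u x l1" and l2: "linked d F (S k) v y l2"
        using UV U V \<open>k = m\<close> by (auto simp: piece_def)
      have "piece k u = piece k v"
        using piece_eq[OF l1] piece_eq[OF xy] piece_eq[OF l2] by simp
      then show False using UV U V \<open>k = m\<close> by simp
    qed
  next
    fix T assume "T \<subseteq> A \<and> T \<noteq> {} \<and> (\<forall>x\<in>T. \<forall>y\<in>T. d x y \<le> \<sigma>)"
    then have T: "T \<subseteq> A" "T \<noteq> {}" "\<And>x y. x \<in> T \<Longrightarrow> y \<in> T \<Longrightarrow> d x y \<le> \<sigma>" by blast+
    then obtain x where x: "x \<in> T" "x \<in> A" by blast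
    define k where "k = \<lfloor>g x / N\<rfloor>"
    have N: "0 < N" using \<sigma> by (simp add: N_def)
    have kx: "of_int k * N \<le> g x" "g x < (of_int k + 1) * N"
      using floor_interval[OF N] by (simp_all add: k_def)
    then have xG: "x \<in> G k" using x \<sigma> by (auto simp: G_def)
    have "y \<in> piece k x" if y: "y \<in> T" for y
    proof -
      have yA: "y \<in> A" and dxy: "d x y \<le> \<sigma>" using T x y by blast+
      have "y \<in> G k" using near_g[OF x(2) yA dxy xG] kx yA by (auto simp: G_def)
      then show ?thesis using near_S[OF x(2) yA dxy xG] by (simp add: piece_def)
    qed
    then have "T \<subseteq> piece k x" by blast
    moreover have "piece k x \<in> \<U> (even k)" using xG by (auto simp: \<U>_def)
    ultimately show "\<exists>c. \<exists>U\<in>\<U> c. T \<subseteq> U" by blast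
  qed
qed

end

section \<open>From annuli to the whole space\<close>

text \<open>Names the common value even if no \<open>y\<close> satisfies \<open>P\<close>, for
  instance when a colour does not occur in a ball.\<close>

lemma subsingleton_choice:
  assumes "\<And>y y'. P y \<Longrightarrow> P y' \<Longrightarrow> v y = v y'"
  obtains V where "\<And>y. P y \<Longrightarrow> v y = V"
  using assms by metis

context plane_length_space
begin

lemma two_colouringD:
  assumes "two_colouring A \<sigma> \<U>"
  shows "U \<in> \<U> c \<Longrightarrow> U \<subseteq> A"
    and "U \<in> \<U> c \<Longrightarrow> x \<in> U \<Longrightarrow> y \<in> U \<Longrightarrow> d x y \<le> 137 * \<sigma>"
    and "S \<subseteq> A \<Longrightarrow> S \<noteq> {} \<Longrightarrow> (\<And>x y. x \<in> S \<Longrightarrow> y \<in> S \<Longrightarrow> d x y \<le> \<sigma>) \<Longrightarrow> \<exists>c. \<exists>U\<in>\<U> c. S \<subseteq> U"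
  using assms by (simp_all add: two_colouring_def)

lemma two_colouring_unique:
  assumes "two_colouring A \<sigma> \<U>" "U \<in> \<U> c" "V \<in> \<U> c" "x \<in> U" "y \<in> V" "d x y \<le> \<sigma>"
  shows "U = V"
proof (rule ccontr)
  assume "U \<noteq> V"
  then have "\<sigma> < d x y" using assms(1-5) unfolding two_colouring_def by simp
  then show False using assms(6) by simp
qed

text \<open>Cut the space along the spheres of radius a multiple of \<open>100 * s\<close> around \<open>z\<close>. Close to such a
  sphere use small pieces \<open>V\<close> of the thin annulus around it, far from it use large pieces of the
  wide annuli. The transition is gradual: first the small pieces of one colour and then those of the
  other colour are replaced by large pieces containing them, so that no ball of radius \<open>s\<close> sees more
  than three pieces.\<close>

lemma ex_cover_multiplicity_3:
  assumes s: "0 < s"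
  obtains \<C> where "\<C> \<subseteq> Pow M" "\<Union>\<C> = M" "\<And>C x y. C \<in> \<C> \<Longrightarrow> x \<in> C \<Longrightarrow> y \<in> C \<Longrightarrow> d x y \<le> 337842 * s"
    "\<And>x. x \<in> M \<Longrightarrow> finite {C \<in> \<C>. C \<inter> mcball x s \<noteq> {}} \<and> card {C \<in> \<C>. C \<inter> mcball x s \<noteq> {}} \<le> 3"
proof (cases "M = {}")
  case True
  then show thesis using that[of "{}"] by simp
next
  case False
  then obtain z where z: "z \<in> M" by blast
  define R where "R = 100 * s"
  have R: "0 < R" using s by (simp add: R_def)
  define f where "f = d z"
  define I where "I i = {x \<in> M. of_int i * R - 9 * s \<le> f x \<and> f x \<le> of_int i * R + 9 * s}" for i :: int
  define A where "A j = {x \<in> M. of_int j * R - 9 * s \<le> f x \<and> f x \<le> (of_int j + 1) * R + 9 * s}" for j :: int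
  have "\<exists>\<V>. two_colouring (I i) (18 * s) \<V>" for i
    unfolding I_def f_def using z s by (intro ex_two_colouring) auto
  then obtain \<V> where \<V>: "\<And>i. two_colouring (I i) (18 * s) (\<V> i)" by metis
  \<comment> \<open>\<open>2466 * s\<close> is the diameter bound for thin pieces, so each of them
    fits into one wide piece; it also exceeds the width \<open>118 * s\<close> of
    \<open>A j\<close>.\<close>
  have "\<exists>\<U>. two_colouring (A j) (2466 * s) \<U>" for j
    unfolding A_def f_def using z s by (intro ex_two_colouring) (auto simp: R_def algebra_simps)
  then obtain \<U> where \<U>: "\<And>j. two_colouring (A j) (2466 * s) (\<U> j)" by metis
  \<comment> \<open>\<open>i x\<close> is the index of the nearest sphere, \<open>e x\<close> the
    radial distance to it, and \<open>j x\<close> the index of the wide annulus containing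
    \<open>x\<close>.\<close>
  define i where "i x = round (f x / R)" for x
  define e where "e x = \<bar>f x - of_int (i x) * R\<bar>" for x
  define j where "j x = \<lfloor>f x / R\<rfloor>" for x
  have e_le: "e x \<le> \<bar>f x - of_int k * R\<bar>" for x k
  proof -
    have "\<bar>f x / R - of_int (i x)\<bar> * R \<le> \<bar>f x / R - of_int k\<bar> * R"
      using R round_diff_minimal[of "f x / R" k] by (intro mult_right_mono) (auto simp: i_def)
    moreover have "\<bar>f x / R - of_int m\<bar> * R = \<bar>f x - of_int m * R\<bar>" for m :: int
      using R by (simp add: abs_mult_pos left_diff_distrib)
    ultimately show ?thesis by (simp add: e_def)
  qed
  have j_bounds: "of_int (j x) * R \<le> f x" "f x < (of_int (j x) + 1) * R" for x
    using floor_interval[OF R] by (simp_all add: j_def)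
  have j_unique: "j x = k" if "of_int k * R \<le> f x" "f x < (of_int k + 1) * R" for x k
    unfolding j_def using that R by (intro floor_unique) (auto simp: field_simps)
  have j_const: "j y = j x" if "2 * s \<le> e x" "\<bar>f y - f x\<bar> \<le> s" for x y
  proof (rule j_unique)
    show "of_int (j x) * R \<le> f y" "f y < (of_int (j x) + 1) * R"
      using j_bounds[of x] e_le[of x "j x"] e_le[of x "j x + 1"] that s by auto
  qed
  \<comment> \<open>Points this close to a sphere share it as nearest one: a second sphere would be
    closer than \<open>18 * s\<close>, but the spheres are \<open>100 * s\<close> apart.\<close>
  have i_const: "i y = i x \<and> \<bar>e y - e x\<bar> \<le> s" if "e x < 8 * s" "\<bar>f y - f x\<bar> \<le> s" for x y
  proof -
    have y: "\<bar>f y - of_int (i x) * R\<bar> \<le> e x + s" using that by (auto simp: e_def)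
    then have ey: "e y \<le> e x + s" using e_le[of y "i x"] by linarith
    have "i y = i x"
    proof (rule ccontr)
      assume "i y \<noteq> i x"
      then have "1 \<le> \<bar>i y - i x\<bar>" by linarith
      then have "1 \<le> \<bar>of_int (i y) - of_int (i x) :: real\<bar>" by linarith
      then have "1 * R \<le> \<bar>of_int (i y) - of_int (i x)\<bar> * R" using R by (intro mult_right_mono) auto
      also have "\<dots> = \<bar>of_int (i y) * R - of_int (i x) * R\<bar>"
        using R by (simp add: abs_mult_pos left_diff_distrib)
      also have "\<dots> \<le> e y + \<bar>f y - of_int (i x) * R\<bar>" by (auto simp: e_def)
      finally show False using ey y that s by (simp add: R_def)
    qed
    moreover have "e x \<le> e y + s" using calculation that(2) by (auto simp: e_def)
    ultimately show ?thesis using ey by auto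
  qed
  have "\<exists>c V. V \<in> \<V> (i x) c \<and> x \<in> V" if x: "x \<in> M" "e x < 9 * s" for x
  proof -
    have "{x} \<subseteq> I (i x)" using x by (auto simp: I_def e_def)
    then show ?thesis using two_colouringD(3)[OF \<V>[of "i x"], of "{x}"] x s by auto
  qed
  then obtain c V where V: "\<And>x. x \<in> M \<Longrightarrow> e x < 9 * s \<Longrightarrow> V x \<in> \<V> (i x) (c x) \<and> x \<in> V x"
    by metis
  have VA: "V x \<subseteq> A (j x)" "\<And>y y'. y \<in> V x \<Longrightarrow> y' \<in> V x \<Longrightarrow> d y y' \<le> 2466 * s"
    if x: "x \<in> M" "e x < 9 * s" for x
  proof -
    note Vx = conjunct1[OF V[OF x]]
    have VI: "V x \<subseteq> I (i x)" by (rule two_colouringD(1)[OF \<V> Vx])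
    show "\<And>y y'. y \<in> V x \<Longrightarrow> y' \<in> V x \<Longrightarrow> d y y' \<le> 2466 * s"
      using two_colouringD(2)[OF \<V> Vx] by fastforce
    \<comment> \<open>The nearest sphere bounds the annulus \<open>j x\<close>, and
      \<open>A j\<close> extends \<open>9 * s\<close> beyond both of its spheres to make room for
      the thin annuli.\<close>
    have "i x = j x \<or> i x = j x + 1"
      unfolding i_def j_def round_def by linarith
    then have "I (i x) \<subseteq> A (j x)" using R by (auto simp: I_def A_def algebra_simps)
    then show "V x \<subseteq> A (j x)" using VI by blast
  qed
  \<comment> \<open>The large piece is chosen as a function of the set \<open>T\<close>, not of a
    point: all points with the same small piece must be moved to the same large piece.\<close>
  have "\<exists>U. \<forall>T. T \<subseteq> A k \<and> T \<noteq> {} \<and> (\<forall>x\<in>T. \<forall>y\<in>T. d x y \<le> 2466 * s) \<longrightarrow> (\<exists>c. U T \<in> \<U> k c) \<and> T \<subseteq> U T" for k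
  proof -
    have "\<exists>W. T \<subseteq> A k \<and> T \<noteq> {} \<and> (\<forall>x\<in>T. \<forall>y\<in>T. d x y \<le> 2466 * s) \<longrightarrow> (\<exists>c. W \<in> \<U> k c) \<and> T \<subseteq> W" for T
      using two_colouringD(3)[OF \<U>[of k], of T] by blast
    then show ?thesis by metis
  qed
  then obtain U where U: "\<And>k T. T \<subseteq> A k \<Longrightarrow> T \<noteq> {} \<Longrightarrow> (\<And>x y. x \<in> T \<Longrightarrow> y \<in> T \<Longrightarrow> d x y \<le> 2466 * s) \<Longrightarrow>
     (\<exists>c. U k T \<in> \<U> k c) \<and> T \<subseteq> U k T"
    by metis
  have UV: "(\<exists>c. U (j x) (V x) \<in> \<U> (j x) c) \<and> x \<in> U (j x) (V x)" if x: "x \<in> M" "e x < 9 * s" for x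
  proof -
    have "V x \<noteq> {}" using V[OF x] by blast
    from U[OF VA(1)[OF x] this VA(2)[OF x]] show ?thesis using V[OF x] by blast
  qed
  have U1: "(\<exists>c. U (j x) {x} \<in> \<U> (j x) c) \<and> x \<in> U (j x) {x}" if x: "x \<in> M" for x
    using U[of "{x}" "j x"] x s j_bounds[of x] by (auto simp: A_def)
  \<comment> \<open>Below \<open>3 * s\<close> both colours use small pieces, from
    \<open>3 * s\<close> on only colour \<open>False\<close> does, and from \<open>6 * s\<close> on
    neither. Beyond \<open>9 * s\<close> no small piece is available and the point itself is
    enlarged.\<close>
  define \<phi> where "\<phi> x = (if e x < 3 * s \<or> e x < 6 * s \<and> \<not> c x then Inl (i x, V x)
     else Inr (j x, if e x < 9 * s then U (j x) (V x) else U (j x) {x}))" for x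
  have \<phi>_Inl: "x \<in> W \<and> (\<exists>c. W \<in> \<V> k c)" if "x \<in> M" "\<phi> x = Inl (k, W)" for x k W
    using that V[of x] s by (auto simp: \<phi>_def split: if_splits)
  have \<phi>_Inr: "x \<in> W \<and> (\<exists>c. W \<in> \<U> k c)" if "x \<in> M" "\<phi> x = Inr (k, W)" for x k W
    using that UV[of x] U1[of x] by (auto simp: \<phi>_def split: if_splits)
  \<comment> \<open>The covering consists of the fibres of \<open>\<phi>\<close>, so the
    multiplicity at a ball is the number of labels occurring on it.\<close>
  define fib where "fib t = {x \<in> M. \<phi> x = t}" for t
  have three: "\<exists>t1 t2 t3. \<forall>y\<in>mcball x s. \<phi> y \<in> {t1, t2, t3}" if x: "x \<in> M" for x
  proof -
    have ball: "y \<in> M" "\<bar>f y - f x\<bar> \<le> s" if "y \<in> mcball x s" for y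
    proof -
      show yM: "y \<in> M" using that by simp
      show "\<bar>f y - f x\<bar> \<le> s"
        using that triangle[OF z x yM] triangle[OF z yM x] commute[of x y] by (auto simp: f_def)
    qed
    have ball2: "d y y' \<le> 2 * s" if "y \<in> mcball x s" "y' \<in> mcball x s" for y y'
      using that triangle[of y x y'] commute[of x y] by auto
    show ?thesis
    proof (cases "e x < 8 * s")
      case False
      \<comment> \<open>All labels here are large pieces of one wide annulus, at most one per
        colour, whether they were chosen for \<open>V y\<close> or for \<open>{y}\<close>.\<close>
      have ex: "\<exists>W. \<forall>y\<in>mcball x s. \<forall>W'\<in>\<U> (j x) k. y \<in> W' \<longrightarrow> W' = W" for k
      proof -
        have "W' = W''" if "y \<in> mcball x s" "y' \<in> mcball x s" "W' \<in> \<U> (j x) k" "W'' \<in> \<U> (j x) k" "y \<in> W'" "y' \<in> W''"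
          for y y' W' W''
          using two_colouring_unique[OF \<U> that(3-6)] ball2[OF that(1,2)] s by auto
        then show ?thesis by metis
      qed
      obtain W where W: "\<And>k y W'. y \<in> mcball x s \<Longrightarrow> W' \<in> \<U> (j x) k \<Longrightarrow> y \<in> W' \<Longrightarrow> W' = W k"
        using ex by metis
      have "\<phi> y \<in> {Inr (j x, W True), Inr (j x, W False), Inr (j x, W False)}" if y: "y \<in> mcball x s" for y
      proof -
        have "j y = j x" using j_const ball[OF y] False s by auto
        have "e x \<le> e y + s" using e_le[of x "i y"] ball(2)[OF y] by (auto simp: e_def)
        then have "6 * s \<le> e y" using False s by auto
        then obtain W' where W': "\<phi> y = Inr (j x, W')" using \<open>j y = j x\<close> s by (auto simp: \<phi>_def)
        then obtain k where "W' \<in> \<U> (j x) k" "y \<in> W'" using \<phi>_Inr[OF ball(1)[OF y] W'] by blast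
        then have "W' = W k" using W y by blast
        then show ?thesis using W' by (cases k) auto
      qed
      then show ?thesis by blast
    next
      case True
      have i: "i y = i x" "\<bar>e y - e x\<bar> \<le> s" "e y < 9 * s" if "y \<in> mcball x s" for y
        using i_const[OF True ball(2)[OF that]] True by auto
      have Vu: "V y = V y'" if "y \<in> mcball x s" "y' \<in> mcball x s" "c y = c y'" for y y'
      proof -
        have "V y \<in> \<V> (i x) (c y)" "y \<in> V y" "V y' \<in> \<V> (i x) (c y)" "y' \<in> V y'"
          using V[OF ball(1)[OF that(1)] i(3)[OF that(1)]] V[OF ball(1)[OF that(2)] i(3)[OF that(2)]]
            i(1)[OF that(1)] i(1)[OF that(2)] that(3) by auto
        then show ?thesis using two_colouring_unique[OF \<V>, of "V y" "i x" "c y" "V y'" y y']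
          ball2[OF that(1,2)] s by auto
      qed
      obtain VT where VT: "\<And>y. y \<in> mcball x s \<and> c y \<Longrightarrow> V y = VT"
        by (rule subsingleton_choice[of "\<lambda>y. y \<in> mcball x s \<and> c y" V]) (use Vu in auto)
      obtain VF where VF: "\<And>y. y \<in> mcball x s \<and> \<not> c y \<Longrightarrow> V y = VF"
        by (rule subsingleton_choice[of "\<lambda>y. y \<in> mcball x s \<and> \<not> c y" V]) (use Vu in auto)
      \<comment> \<open>On the ball \<open>e\<close> varies by at most \<open>s\<close> from
        \<open>e x\<close>, so at most one of the thresholds \<open>3 * s\<close> and
        \<open>6 * s\<close> is crossed. In the last two cases the ball crosses no sphere, so
        \<open>j\<close> is constant. Each time one colour has a single label and the other at most
        two, before and after replacement.\<close>
      consider "e x < 2 * s" | "2 * s \<le> e x" "e x < 5 * s" | "5 * s \<le> e x" by linarith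
      then show ?thesis
      proof cases
        case 1
        have "\<phi> y \<in> {Inl (i x, VT), Inl (i x, VF), Inl (i x, VF)}" if y: "y \<in> mcball x s" for y
          using i[OF y] VT[of y] VF[of y] y 1 by (cases "c y") (auto simp: \<phi>_def)
        then show ?thesis by blast
      next
        case 2
        have "\<phi> y \<in> {Inl (i x, VT), Inl (i x, VF), Inr (j x, U (j x) VT)}" if y: "y \<in> mcball x s" for y
          using i[OF y] VT[of y] VF[of y] y 2 j_const[OF 2(1) ball(2)[OF y]] by (cases "c y") (auto simp: \<phi>_def)
        then show ?thesis by blast
      next
        case 3
        then have "2 * s \<le> e x" using s by auto
        have "\<phi> y \<in> {Inr (j x, U (j x) VT), Inl (i x, VF), Inr (j x, U (j x) VF)}" if y: "y \<in> mcball x s" for y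
          using i[OF y] VT[of y] VF[of y] y 3 s j_const[OF \<open>2 * s \<le> e x\<close> ball(2)[OF y]]
          by (cases "c y") (auto simp: \<phi>_def)
        then show ?thesis by blast
      qed
    qed
  qed
  show thesis
  proof (rule that[of "fib ` \<phi> ` M"])
    show "fib ` \<phi> ` M \<subseteq> Pow M" "\<Union> (fib ` \<phi> ` M) = M" by (auto simp: fib_def)
  next
    fix C x y assume C: "C \<in> fib ` \<phi> ` M" "x \<in> C" "y \<in> C"
    then obtain t where t: "\<phi> x = t" "\<phi> y = t" "x \<in> M" "y \<in> M" by (auto simp: fib_def)
    show "d x y \<le> 337842 * s"
    proof (cases t)
      case (Inl p)
      obtain k W where p: "p = (k, W)" by (cases p)
      have "x \<in> W" "y \<in> W" "\<exists>c. W \<in> \<V> k c"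
        using \<phi>_Inl[of x k W] \<phi>_Inl[of y k W] t Inl p by auto
      then have "d x y \<le> 137 * (18 * s)" using two_colouringD(2)[OF \<V>] by blast
      then show ?thesis using s by simp
    next
      case (Inr p)
      obtain k W where p: "p = (k, W)" by (cases p)
      have "x \<in> W" "y \<in> W" "\<exists>c. W \<in> \<U> k c"
        using \<phi>_Inr[of x k W] \<phi>_Inr[of y k W] t Inr p by auto
      then have "d x y \<le> 137 * (2466 * s)" using two_colouringD(2)[OF \<U>] by blast
      then show ?thesis using s by simp
    qed
  next
    fix x assume "x \<in> M"
    then obtain t1 t2 t3 where t: "\<forall>y\<in>mcball x s. \<phi> y \<in> {t1, t2, t3}" using three by blast
    have sub: "{C \<in> fib ` \<phi> ` M. C \<inter> mcball x s \<noteq> {}} \<subseteq> {fib t1, fib t2, fib t3}"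
      using t by (auto simp: fib_def)
    then have "card {C \<in> fib ` \<phi> ` M. C \<inter> mcball x s \<noteq> {}} \<le> card {fib t1, fib t2, fib t3}"
      by (intro card_mono) auto
    also have "\<dots> \<le> 3" by (simp add: card_insert_if)
    finally show "finite {C \<in> fib ` \<phi> ` M. C \<inter> mcball x s \<noteq> {}} \<and> card {C \<in> fib ` \<phi> ` M. C \<inter> mcball x s \<noteq> {}} \<le> 3"
      using finite_subset[OF sub] by auto
  qed
qed

end

section \<open>Planar spaces and planar graphs\<close>

lemma nagata_dim_leI:
  assumes "0 < c"
    and "\<And>s. 0 < s \<Longrightarrow> \<exists>\<C>. \<C> \<subseteq> Pow (mspace m) \<and> \<Union>\<C> = mspace m \<and>
      (\<forall>C\<in>\<C>. \<forall>x\<in>C. \<forall>y\<in>C. mdist m x y \<le> c * s) \<and>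
      (\<forall>x\<in>mspace m. finite {C\<in>\<C>. C \<inter> mcball_of m x s \<noteq> {}} \<and>
         card {C\<in>\<C>. C \<inter> mcball_of m x s \<noteq> {}} \<le> n + 1)"
  shows "nagata_dim_le m n c"
  unfolding nagata_dim_le_def
proof (intro conjI allI impI)
  fix s :: real assume s: "0 < s"
  obtain \<C> where \<C>: "\<C> \<subseteq> Pow (mspace m)" "\<Union>\<C> = mspace m"
      "\<forall>C\<in>\<C>. \<forall>x\<in>C. \<forall>y\<in>C. mdist m x y \<le> c * s"
      "\<forall>x\<in>mspace m. finite {C\<in>\<C>. C \<inter> mcball_of m x s \<noteq> {}} \<and>
         card {C\<in>\<C>. C \<inter> mcball_of m x s \<noteq> {}} \<le> n + 1"
    using assms(2)[OF s] by (elim exE conjE) (rule that; assumption)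
  have "bounded_family m (c * s) \<C>"
    unfolding bounded_family_def diam_def using \<C>(3) by (auto intro!: Sup_least)
  moreover have "multiplicity_at m s \<C> \<le> enat (n + 1)"
    unfolding multiplicity_at_def using \<C>(4) by (intro Inf_lower) blast
  ultimately show "\<exists>\<C>. \<C> \<subseteq> Pow (mspace m) \<and> \<Union>\<C> = mspace m \<and> bounded_family m (c * s) \<C> \<and>
      multiplicity_at m s \<C> \<le> enat (n + 1)"
    using \<C> by blast
qed (rule assms(1))

lemma nagata_dim_plane_length_space:
  assumes "plane_length_space (mspace m) (mdist m) F"
  shows "nagata_dim_le m 2 337842"
proof (rule nagata_dim_leI)
  interpret plane_length_space "mspace m" "mdist m" F by (rule assms)
  fix s :: real assume "0 < s"
  then obtain \<C> where "\<C> \<subseteq> Pow (mspace m)" "\<Union>\<C> = mspace m"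
    "\<And>C x y. C \<in> \<C> \<Longrightarrow> x \<in> C \<Longrightarrow> y \<in> C \<Longrightarrow> mdist m x y \<le> 337842 * s"
    "\<And>x. x \<in> mspace m \<Longrightarrow> finite {C \<in> \<C>. C \<inter> mcball x s \<noteq> {}} \<and> card {C \<in> \<C>. C \<inter> mcball x s \<noteq> {}} \<le> 3"
    by (rule ex_cover_multiplicity_3) blast
  then show "\<exists>\<C>. \<C> \<subseteq> Pow (mspace m) \<and> \<Union>\<C> = mspace m \<and>
      (\<forall>C\<in>\<C>. \<forall>x\<in>C. \<forall>y\<in>C. mdist m x y \<le> 337842 * s) \<and>
      (\<forall>x\<in>mspace m. finite {C\<in>\<C>. C \<inter> mcball_of m x s \<noteq> {}} \<and>
         card {C\<in>\<C>. C \<inter> mcball_of m x s \<noteq> {}} \<le> 2 + 1)"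
    by (intro exI[of _ \<C>]) (simp add: mcball_of_def)
qed simp

lemma nagata_dim_isometry:
  assumes nag: "nagata_dim_le m' n c" and \<Phi>: "bij_betw \<Phi> (mspace m) (mspace m')"
    and iso: "\<And>x y. x \<in> mspace m \<Longrightarrow> y \<in> mspace m \<Longrightarrow> mdist m' (\<Phi> x) (\<Phi> y) = mdist m x y"
  shows "nagata_dim_le m n c"
  unfolding nagata_dim_le_def
proof (intro conjI allI impI)
  show "0 < c" using nag by (simp add: nagata_dim_le_def)
  fix s :: real assume s: "0 < s"
  have "\<exists>\<C>'. \<C>' \<subseteq> Pow (mspace m') \<and> \<Union>\<C>' = mspace m' \<and> bounded_family m' (c * s) \<C>' \<and>
      multiplicity_at m' s \<C>' \<le> enat (n + 1)"
    using nag s by (simp add: nagata_dim_le_def)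
  then obtain \<C>' where \<C>': "\<C>' \<subseteq> Pow (mspace m')" "\<Union>\<C>' = mspace m'" "bounded_family m' (c * s) \<C>'"
    "multiplicity_at m' s \<C>' \<le> enat (n + 1)"
    by (elim exE conjE) (rule that; assumption)
  have im: "\<Phi> x \<in> mspace m'" if "x \<in> mspace m" for x using bij_betwE[OF \<Phi>] that by blast
  define pre where "pre C = {x \<in> mspace m. \<Phi> x \<in> C}" for C
  have "bounded_family m (c * s) (pre ` \<C>')"
    unfolding bounded_family_def
  proof
    fix C assume "C \<in> pre ` \<C>'"
    then obtain C' where C': "C' \<in> \<C>'" "C = pre C'" by blast
    have "diam m C \<le> diam m' C'"
      unfolding diam_def
    proof (rule Sup_subset_mono, clarify)
      fix x y assume "x \<in> C" "y \<in> C"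
      then have xy: "x \<in> mspace m" "y \<in> mspace m" "\<Phi> x \<in> C'" "\<Phi> y \<in> C'" using C' by (auto simp: pre_def)
      show "\<exists>x' y'. ereal (mdist m x y) = ereal (mdist m' x' y') \<and> x' \<in> C' \<and> y' \<in> C'"
        using xy iso[OF xy(1,2)] by (intro exI[of _ "\<Phi> x"] exI[of _ "\<Phi> y"]) simp
    qed
    also have "\<dots> \<le> ereal (c * s)" using \<C>'(3) C' by (simp add: bounded_family_def)
    finally show "diam m C \<le> ereal (c * s)" .
  qed
  moreover have "multiplicity_at m s (pre ` \<C>') \<le> multiplicity_at m' s \<C>'"
    unfolding multiplicity_at_def
  proof (rule Inf_superset_mono, clarify)
    fix k assume k: "\<forall>x\<in>mspace m'. finite {C \<in> \<C>'. C \<inter> mcball_of m' x s \<noteq> {}} \<and>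
      card {C \<in> \<C>'. C \<inter> mcball_of m' x s \<noteq> {}} \<le> k"
    have "finite {C \<in> pre ` \<C>'. C \<inter> mcball_of m x s \<noteq> {}} \<and> card {C \<in> pre ` \<C>'. C \<inter> mcball_of m x s \<noteq> {}} \<le> k"
      if x: "x \<in> mspace m" for x
    proof -
      let ?H = "{C \<in> \<C>'. C \<inter> mcball_of m' (\<Phi> x) s \<noteq> {}}"
      have sub: "{C \<in> pre ` \<C>'. C \<inter> mcball_of m x s \<noteq> {}} \<subseteq> pre ` ?H"
      proof
        fix C assume "C \<in> {C \<in> pre ` \<C>'. C \<inter> mcball_of m x s \<noteq> {}}"
        then obtain C' y where C': "C' \<in> \<C>'" "C = pre C'" "y \<in> C" "y \<in> mcball_of m x s" by blast
        then have "\<Phi> y \<in> C' \<inter> mcball_of m' (\<Phi> x) s"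
          using iso[OF x, of y] im x by (auto simp: pre_def)
        then show "C \<in> pre ` ?H" using C' by blast
      qed
      have H: "finite ?H" "card ?H \<le> k" using k im[OF x] by auto
      have "card {C \<in> pre ` \<C>'. C \<inter> mcball_of m x s \<noteq> {}} \<le> card (pre ` ?H)"
        using H by (intro card_mono sub) auto
      also have "\<dots> \<le> k" using card_image_le[OF H(1), of pre] H(2) by linarith
      finally show ?thesis using finite_subset[OF sub] H by blast
    qed
    then show "\<exists>k'. enat k = enat k' \<and> (\<forall>x\<in>mspace m. finite {C \<in> pre ` \<C>'. C \<inter> mcball_of m x s \<noteq> {}} \<and>
      card {C \<in> pre ` \<C>'. C \<inter> mcball_of m x s \<noteq> {}} \<le> k')" by blast
  qed
  moreover have "\<Union> (pre ` \<C>') = mspace m"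
  proof -
    have "x \<in> \<Union> (pre ` \<C>')" if "x \<in> mspace m" for x
      using im[OF that] that \<C>'(2) by (auto simp: pre_def)
    then show ?thesis by (auto simp: pre_def)
  qed
  ultimately show "\<exists>\<C>. \<C> \<subseteq> Pow (mspace m) \<and> \<Union>\<C> = mspace m \<and> bounded_family m (c * s) \<C> \<and>
      multiplicity_at m s \<C> \<le> enat (n + 1)"
    using \<C>'(4) by (intro exI[of _ "pre ` \<C>'"]) (auto simp: pre_def)
qed

section \<open>Planar geodesic spaces and planar graphs as plane length spaces\<close>

lemma continuous_map_lipschitz_interval:
  assumes "\<gamma> \<in> {a..b} \<rightarrow> mspace m"
    and "\<And>s t. s \<in> {a..b} \<Longrightarrow> t \<in> {a..b} \<Longrightarrow> mdist m (\<gamma> s) (\<gamma> t) \<le> \<bar>s - t\<bar>"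
  shows "continuous_map (top_of_set {a..b}) (mtopology_of m) \<gamma>"
proof -
  have "Lipschitz_continuous_map (submetric euclidean_metric {a..b}) m \<gamma>"
    unfolding Lipschitz_continuous_map_def using assms by (auto simp: dist_real_def intro!: exI[of _ 1])
  then have "continuous_map (mtopology_of (submetric euclidean_metric {a..b})) (mtopology_of m) \<gamma>"
    by (intro uniformly_continuous_imp_continuous_map Cauchy_continuous_imp_continuous_map
        Lipschitz_imp_uniformly_continuous_map)
  then show ?thesis by (simp add: mtopology_of_submetric)
qed

lemma isometry_continuous_map:
  assumes "\<Phi> \<in> mspace m \<rightarrow> mspace m'"
    and "\<And>x y. x \<in> mspace m \<Longrightarrow> y \<in> mspace m \<Longrightarrow> mdist m' (\<Phi> x) (\<Phi> y) = mdist m x y"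
  shows "continuous_map (mtopology_of m) (mtopology_of m') \<Phi>"
proof -
  have "Lipschitz_continuous_map m m' \<Phi>"
    unfolding Lipschitz_continuous_map_def using assms by (auto intro!: exI[of _ 1])
  then show ?thesis
    by (intro uniformly_continuous_imp_continuous_map Lipschitz_imp_uniformly_continuous_map)
qed

definition complex_of_vec :: "real^2 \<Rightarrow> complex" where
  "complex_of_vec v = Complex (v $ 1) (v $ 2)"

lemma inj_complex_of_vec: "inj complex_of_vec"
  by (auto simp: inj_def complex_of_vec_def vec_eq_iff forall_2)

lemma continuous_on_complex_of_vec: "continuous_on A complex_of_vec"
  unfolding complex_of_vec_def by (intro continuous_intros)

lemma planar_geodesic_plane_length_space:
  assumes geo: "geodesic_space m" and f: "continuous_map (mtopology_of m) euclidean f" "inj_on f (mspace m)"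
  shows "plane_length_space (mspace m) (mdist m) (complex_of_vec \<circ> f)"
proof -
  interpret Metric_space "mspace m" "mdist m" by simp
  show ?thesis
  proof
    show "inj_on (complex_of_vec \<circ> f) (mspace m)"
      using f(2) inj_complex_of_vec by (auto intro: comp_inj_on inj_on_subset)
    fix x y and \<epsilon> :: real assume xy: "x \<in> mspace m" "y \<in> mspace m" and "0 < \<epsilon>"
    obtain \<gamma> where \<gamma>: "\<gamma> \<in> {0..mdist m x y} \<rightarrow> mspace m" "\<gamma> 0 = x" "\<gamma> (mdist m x y) = y"
      "\<forall>s\<in>{0..mdist m x y}. \<forall>t\<in>{0..mdist m x y}. mdist m (\<gamma> s) (\<gamma> t) = \<bar>s - t\<bar>"
      using geo xy unfolding geodesic_space_def by blast
    have "continuous_map (top_of_set {0..mdist m x y}) (mtopology_of m) \<gamma>"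
      using \<gamma> by (intro continuous_map_lipschitz_interval) auto
    then have "continuous_map (top_of_set {0..mdist m x y}) euclidean (f \<circ> \<gamma>)"
      using f(1) continuous_map_compose by blast
    then have "continuous_on {0..mdist m x y} (f \<circ> \<gamma>)" by simp
    then have "continuous_on {0..mdist m x y} (complex_of_vec \<circ> (f \<circ> \<gamma>))"
      by (intro continuous_on_compose continuous_on_complex_of_vec)
    then have "lip_path (mdist m) (complex_of_vec \<circ> f) (mspace m) \<gamma> (mdist m x y)"
      using \<gamma> by (auto simp: lip_path_def comp_assoc)
    then show "\<exists>l\<le>mdist m x y + \<epsilon>. linked (mdist m) (complex_of_vec \<circ> f) (mspace m) x y l"
      using \<gamma> \<open>0 < \<epsilon>\<close> by (intro exI[of _ "mdist m x y"]) (auto simp: linked_def)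
  qed
qed

lemma graph_dist_le_pl_path:
  assumes G: "connected_graph G" and p: "pl_path G x y l"
  shows "graph_dist G x y \<le> l"
proof -
  have wf: "wf_digraph G" using G by (simp add: connected_graph_def)
  have "bdd_below {l. pl_path G x y l}" using pl_path_points[OF wf] by (auto intro!: bdd_belowI[of _ 0])
  then show ?thesis using p pl_path_points[OF wf p] by (auto simp: graph_dist_def intro!: cInf_lower)
qed

text \<open>A piecewise linear path is a finite concatenation of edge segments. Continuity on closed
  edges therefore gives continuity along the path, even through a vertex where \<open>f\<close> is
  discontinuous.\<close>

lemma planar_graph_plane_length_space:
  assumes G: "connected_graph G" and inj: "inj_on f (graph_points G)"
    and f: "\<forall>e\<in>arcs G. continuous_map
        (subtopology (mtopology_of (graph_metric G)) (closed_edge G e)) euclidean f"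
  shows "plane_length_space (graph_points G) (graph_dist G) (complex_of_vec \<circ> f)"
proof -
  have wf: "wf_digraph G" using G by (simp add: connected_graph_def)
  interpret Metric_space "graph_points G" "graph_dist G" by (rule Metric_space_graph[OF G])
  let ?F = "complex_of_vec \<circ> f"
  have edge: "linked (graph_dist G) ?F (graph_points G) (edge_point G e s) (edge_point G e t) (t - s)"
    if e: "e \<in> arcs G" and st: "0 \<le> s" "s \<le> t" "t \<le> 1" for e s t
  proof -
    define \<gamma> where "\<gamma> u = edge_point G e (s + u)" for u
    have pts: "\<gamma> u \<in> graph_points G" "\<gamma> u \<in> closed_edge G e" if "u \<in> {0..t - s}" for u
      using edge_point_in[OF wf e, of "s + u"] that st by (auto simp: \<gamma>_def closed_edge_def)
    have lip: "graph_dist G (\<gamma> u) (\<gamma> v) \<le> \<bar>u - v\<bar>" if "u \<in> {0..t - s}" "v \<in> {0..t - s}" for u v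
      using graph_dist_le_pl_path[OF G pl_path_edge[OF wf e, of "s + u" "s + v"]] that st
      by (simp add: \<gamma>_def)
    have "continuous_map (top_of_set {0..t - s}) (mtopology_of (graph_metric G)) \<gamma>"
      using pts lip by (intro continuous_map_lipschitz_interval) (auto simp: graph_metric_simps[OF G])
    then have "continuous_map (top_of_set {0..t - s}) (subtopology (mtopology_of (graph_metric G)) (closed_edge G e)) \<gamma>"
      using pts by (auto simp: continuous_map_in_subtopology)
    then have "continuous_map (top_of_set {0..t - s}) euclidean (f \<circ> \<gamma>)"
      using f e continuous_map_compose by blast
    then have "continuous_on {0..t - s} (f \<circ> \<gamma>)" by simp
    then have "continuous_on {0..t - s} (complex_of_vec \<circ> (f \<circ> \<gamma>))"
      by (intro continuous_on_compose continuous_on_complex_of_vec)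
    then have "lip_path (graph_dist G) ?F (graph_points G) \<gamma> (t - s)"
      using pts lip st by (auto simp: lip_path_def comp_assoc)
    then show ?thesis by (auto simp: linked_def \<gamma>_def intro!: exI[of _ \<gamma>])
  qed
  have linked: "linked (graph_dist G) ?F (graph_points G) x y l" if "pl_path G x y l" for x y l
    using that
  proof (induction rule: pl_path.induct)
    case (refl x)
    then show ?case by (intro linked_refl) auto
  next
    case (step e s t y l)
    have "linked (graph_dist G) ?F (graph_points G) (edge_point G e s) (edge_point G e t) \<bar>s - t\<bar>"
    proof (cases "s \<le> t")
      case True
      then show ?thesis using edge[OF step(1), of s t] step(2,3) by simp
    next
      case False
      then show ?thesis using linked_sym[OF edge[OF step(1), of t s]] step(2,3) by simp
    qed
    then show ?case using linked_trans step.IH by blast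
  qed
  show ?thesis
  proof
    show "inj_on ?F (graph_points G)"
      using inj inj_complex_of_vec by (auto intro: comp_inj_on inj_on_subset)
    fix x y and \<epsilon> :: real assume xy: "x \<in> graph_points G" "y \<in> graph_points G" and \<epsilon>: "0 < \<epsilon>"
    then have "Inf {l. pl_path G x y l} < graph_dist G x y + \<epsilon>" by (simp add: graph_dist_def)
    then obtain l where "pl_path G x y l" "l < graph_dist G x y + \<epsilon>"
      using cInf_lessD[of "{l. pl_path G x y l}"] pl_path_exists[OF G xy] by auto
    then show "\<exists>l\<le>graph_dist G x y + \<epsilon>. linked (graph_dist G) ?F (graph_points G) x y l"
      using linked by (intro exI[of _ l]) auto
  qed
qed

section \<open>Copies over the plane\<close>

text \<open>The plane supplies only names for the points: the copy carries the metric of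
  \<open>m\<close>, not the Euclidean one. On its carrier \<open>f \<circ> g\<close> is the
  identity, continuous because \<open>g\<close> is an isometry.\<close>

lemma planar_space_copy:
  fixes m :: "'a metric"
  assumes geo: "geodesic_space m" and planar: "planar_space m"
  shows "\<exists>(m' :: (real^2) metric) \<Phi>. geodesic_space m' \<and> planar_space m' \<and>
    bij_betw \<Phi> (mspace m) (mspace m') \<and>
    (\<forall>x\<in>mspace m. \<forall>y\<in>mspace m. mdist m' (\<Phi> x) (\<Phi> y) = mdist m x y)"
proof -
  obtain f :: "'a \<Rightarrow> real^2" where f: "continuous_map (mtopology_of m) euclidean f" and inj: "inj_on f (mspace m)"
    using planar by (auto simp: planar_space_def)
  define g where "g = inv_into (mspace m) f"
  have gf: "g (f x) = x" if "x \<in> mspace m" for x using inj that by (simp add: g_def)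
  interpret copy: Metric_space "f ` mspace m" "\<lambda>u v. mdist m (g u) (g v)"
  proof
    fix x y assume "x \<in> f ` mspace m" "y \<in> f ` mspace m"
    then show "(mdist m (g x) (g y) = 0) = (x = y)" using gf by auto
  next
    fix x y z assume "x \<in> f ` mspace m" "y \<in> f ` mspace m" "z \<in> f ` mspace m"
    then show "mdist m (g x) (g z) \<le> mdist m (g x) (g y) + mdist m (g y) (g z)"
      using gf by (auto intro: mdist_triangle)
  qed (auto simp: mdist_commute)
  define m' where "m' = metric (f ` mspace m, \<lambda>u v. mdist m (g u) (g v))"
  have m': "mspace m' = f ` mspace m" "mdist m' = (\<lambda>u v. mdist m (g u) (g v))"
    by (simp_all add: m'_def)
  have iso: "mdist m' (f x) (f y) = mdist m x y" if "x \<in> mspace m" "y \<in> mspace m" for x y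
    using gf that by (simp add: m')
  show ?thesis
  proof (intro exI[of _ m'] exI[of _ f] conjI ballI)
    show "geodesic_space m'"
      unfolding geodesic_space_def
    proof (intro ballI)
      fix u v assume "u \<in> mspace m'" "v \<in> mspace m'"
      then obtain x y where xy: "u = f x" "v = f y" "x \<in> mspace m" "y \<in> mspace m" by (auto simp: m')
      obtain \<gamma> where \<gamma>: "\<gamma> \<in> {0..mdist m x y} \<rightarrow> mspace m" "\<gamma> 0 = x" "\<gamma> (mdist m x y) = y"
        "\<forall>s\<in>{0..mdist m x y}. \<forall>t\<in>{0..mdist m x y}. mdist m (\<gamma> s) (\<gamma> t) = \<bar>s - t\<bar>"
        using geo xy unfolding geodesic_space_def by blast
      have uv: "mdist m' u v = mdist m x y" using iso xy by simp
      have "mdist m' (f (\<gamma> s)) (f (\<gamma> t)) = \<bar>s - t\<bar>" if "s \<in> {0..mdist m x y}" "t \<in> {0..mdist m x y}" for s t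
        using \<gamma>(1,4) that iso[of "\<gamma> s" "\<gamma> t"] by (simp add: Pi_iff)
      then show "\<exists>\<gamma>. \<gamma> \<in> {0..mdist m' u v} \<rightarrow> mspace m' \<and> \<gamma> 0 = u \<and> \<gamma> (mdist m' u v) = v \<and>
        (\<forall>s\<in>{0..mdist m' u v}. \<forall>t\<in>{0..mdist m' u v}. mdist m' (\<gamma> s) (\<gamma> t) = \<bar>s - t\<bar>)"
        unfolding uv using \<gamma>(1-3) xy by (intro exI[of _ "f \<circ> \<gamma>"]) (auto simp: m'(1) Pi_iff)
    qed
    have "continuous_map (mtopology_of m') (mtopology_of m) g"
      using gf by (intro isometry_continuous_map) (auto simp: m')
    then have "continuous_map (mtopology_of m') euclidean (f \<circ> g)"
      using f continuous_map_compose by blast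
    moreover have "inj_on (f \<circ> g) (mspace m')" using gf by (auto simp: m' inj_on_def)
    ultimately show "planar_space m'" unfolding planar_space_def by blast
    show "bij_betw f (mspace m) (mspace m')" using inj by (simp add: m' bij_betw_def)
  qed (fact iso)
qed

section \<open>Isomorphisms of graphs and transport of planarity\<close>

locale graph_iso =
  fixes G :: "('v, 'e) pre_digraph" and H :: "('w, 'k) pre_digraph"
    and \<alpha> :: "'v \<Rightarrow> 'w" and \<beta> :: "'e \<Rightarrow> 'k"
  assumes wf: "wf_digraph G"
    and vert_bij: "bij_betw \<alpha> (verts G) (verts H)" and arc_bij: "bij_betw \<beta> (arcs G) (arcs H)"
    and tail_\<beta>: "\<And>e. e \<in> arcs G \<Longrightarrow> tail H (\<beta> e) = \<alpha> (tail G e)"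
    and head_\<beta>: "\<And>e. e \<in> arcs G \<Longrightarrow> head H (\<beta> e) = \<alpha> (head G e)"
begin

abbreviation "\<Phi> \<equiv> map_graph_point \<alpha> \<beta>"

lemma vert_in: "v \<in> verts G \<Longrightarrow> \<alpha> v \<in> verts H" using vert_bij by (auto simp: bij_betw_def)
lemma arc_in: "e \<in> arcs G \<Longrightarrow> \<beta> e \<in> arcs H" using arc_bij by (auto simp: bij_betw_def)

lemma edge_point_map: "e \<in> arcs G \<Longrightarrow> \<Phi> (edge_point G e t) = edge_point H (\<beta> e) t"
  by (simp add: edge_point_def tail_\<beta> head_\<beta>)

lemma point_in: "x \<in> graph_points G \<Longrightarrow> \<Phi> x \<in> graph_points H"
  using vert_in arc_in by (auto simp: graph_points_def)

lemma wf': "wf_digraph H"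
proof
  fix a assume "a \<in> arcs H"
  then obtain e where "a = \<beta> e" "e \<in> arcs G" using arc_bij by (auto simp: bij_betw_def)
  then show "tail H a \<in> verts H" "head H a \<in> verts H"
    using vert_in wf_digraph.tail_in_verts[OF wf] wf_digraph.head_in_verts[OF wf]
    by (simp_all add: tail_\<beta> head_\<beta>)
qed

lemma pl_path_map: "pl_path G x y l \<Longrightarrow> pl_path H (\<Phi> x) (\<Phi> y) l"
proof (induction rule: pl_path.induct)
  case (refl x)
  then show ?case using point_in by (intro pl_path.refl)
next
  case (step e s t y l)
  then show ?case using pl_path.step[of "\<beta> e" H s t "\<Phi> y" l] arc_in by (simp add: edge_point_map)
qed

lemma reachable_map:
  assumes "(u, v) \<in> rtrancl_on (verts G) (parcs (mk_symmetric G))"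
  shows "(\<alpha> u, \<alpha> v) \<in> rtrancl_on (verts H) (parcs (mk_symmetric H))"
  using assms
proof (induction rule: rtrancl_on.induct)
  case (rtrancl_on_refl a)
  then show ?case using vert_in by blast
next
  case (rtrancl_on_into_rtrancl_on a b c)
  obtain e where "e \<in> arcs G" "(b, c) = (tail G e, head G e) \<or> (b, c) = (head G e, tail G e)"
    using rtrancl_on_into_rtrancl_on.hyps(2) by (auto simp: parcs_mk_symmetric)
  then have "(\<alpha> b, \<alpha> c) \<in> parcs (mk_symmetric H)"
    using arc_in[of e] tail_\<beta>[of e] head_\<beta>[of e] by (auto simp: parcs_mk_symmetric intro!: bexI[of _ "\<beta> e"])
  then show ?case
    using rtrancl_on_into_rtrancl_on vert_in by (meson rtrancl_on.rtrancl_on_into_rtrancl_on)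
qed

lemma connected_map:
  assumes "connected_graph G"
  shows "connected_graph H"
proof -
  have conn: "Digraph_Component.connected G" using assms by (simp add: connected_graph_def)
  have "verts H = \<alpha> ` verts G" using vert_bij by (simp add: bij_betw_def)
  moreover have "verts G \<noteq> {}" using conn
    by (auto simp: Digraph_Component.connected_def strongly_connected_def)
  moreover have "(u, v) \<in> rtrancl_on (verts G) (parcs (mk_symmetric G))" if "u \<in> verts G" "v \<in> verts G" for u v
    using conn that by (auto simp: Digraph_Component.connected_def strongly_connected_def reachable_def)
  ultimately have "Digraph_Component.connected H"
    using reachable_map by (auto simp: Digraph_Component.connected_def strongly_connected_def reachable_def)
  then show ?thesis using wf' by (simp add: connected_graph_def)
qed

end

lemma graph_iso_inverse:
  assumes "graph_iso G H \<alpha> \<beta>"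
  shows "graph_iso H G (inv_into (verts G) \<alpha>) (inv_into (arcs G) \<beta>)"
proof -
  interpret graph_iso G H \<alpha> \<beta> by (rule assms)
  have inj: "inj_on \<alpha> (verts G)" "inj_on \<beta> (arcs G)" using vert_bij arc_bij by (auto simp: bij_betw_def)
  show ?thesis
  proof
    fix a assume "a \<in> arcs H"
    then obtain e where "a = \<beta> e" "e \<in> arcs G" using arc_bij by (auto simp: bij_betw_def)
    then show "tail G (inv_into (arcs G) \<beta> a) = inv_into (verts G) \<alpha> (tail H a)"
      "head G (inv_into (arcs G) \<beta> a) = inv_into (verts G) \<alpha> (head H a)"
      using inj wf_digraph.tail_in_verts[OF wf] wf_digraph.head_in_verts[OF wf] by (simp_all add: tail_\<beta> head_\<beta>)
  qed (use wf' vert_bij arc_bij in \<open>auto intro: bij_betw_inv_into simp: wf_digraph_def\<close>)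
qed

text \<open>The isomorphism and its inverse both preserve piecewise linear paths with their lengths,
  so the infima are over the same set.\<close>

lemma graph_iso_graph_dist:
  assumes iso: "graph_iso G H \<alpha> \<beta>"
  shows "bij_betw (map_graph_point \<alpha> \<beta>) (graph_points G) (graph_points H)"
    and "x \<in> graph_points G \<Longrightarrow> y \<in> graph_points G \<Longrightarrow>
      graph_dist H (map_graph_point \<alpha> \<beta> x) (map_graph_point \<alpha> \<beta> y) = graph_dist G x y"
proof -
  interpret graph_iso G H \<alpha> \<beta> by (rule iso)
  interpret I: graph_iso H G "inv_into (verts G) \<alpha>" "inv_into (arcs G) \<beta>" by (rule graph_iso_inverse[OF iso])
  have inj: "inj_on \<alpha> (verts G)" "inj_on \<beta> (arcs G)" and im: "\<alpha> ` verts G = verts H" "\<beta> ` arcs G = arcs H"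
    using vert_bij arc_bij by (auto simp: bij_betw_def)
  have inv: "I.\<Phi> (\<Phi> x) = x" if "x \<in> graph_points G" for x
    using that inj by (auto simp: graph_points_def)
  have inv': "\<Phi> (I.\<Phi> w) = w" if "w \<in> graph_points H" for w
    using that im by (auto simp: graph_points_def f_inv_into_f)
  show "bij_betw \<Phi> (graph_points G) (graph_points H)"
    by (rule bij_betwI[of _ _ _ I.\<Phi>]) (use point_in I.point_in inv inv' in auto)
  assume xy: "x \<in> graph_points G" "y \<in> graph_points G"
  have "pl_path H (\<Phi> x) (\<Phi> y) l \<longleftrightarrow> pl_path G x y l" for l
    using pl_path_map[of x y l] I.pl_path_map[of "\<Phi> x" "\<Phi> y" l] inv[OF xy(1)] inv[OF xy(2)] by auto
  then have "pl_path H (\<Phi> x) (\<Phi> y) = pl_path G x y" by blast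
  then show "graph_dist H (\<Phi> x) (\<Phi> y) = graph_dist G x y"
    using xy point_in by (simp add: graph_dist_def)
qed

lemma planar_graph_map:
  assumes iso: "graph_iso G H \<alpha> \<beta>" and G: "connected_graph G" and planar: "planar_graph G"
  shows "planar_graph H"
proof -
  interpret graph_iso G H \<alpha> \<beta> by (rule iso)
  interpret I: graph_iso H G "inv_into (verts G) \<alpha>" "inv_into (arcs G) \<beta>" by (rule graph_iso_inverse[OF iso])
  note iso' = graph_iso_inverse[OF iso]
  have H: "connected_graph H" by (rule connected_map[OF G])
  obtain f :: "('a, 'b) graph_point \<Rightarrow> real^2" where f: "inj_on f (graph_points G)"
    "\<forall>e\<in>arcs G. continuous_map (subtopology (mtopology_of (graph_metric G)) (closed_edge G e)) euclidean f"
    using planar by (auto simp: planar_graph_def)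
  have cont: "continuous_map (mtopology_of (graph_metric H)) (mtopology_of (graph_metric G)) I.\<Phi>"
    using I.point_in graph_iso_graph_dist(2)[OF iso']
    by (intro isometry_continuous_map) (auto simp: graph_metric_simps G H)
  have "bij_betw I.\<Phi> (graph_points H) (graph_points G)" by (rule graph_iso_graph_dist(1)[OF iso'])
  then have "inj_on (f \<circ> I.\<Phi>) (graph_points H)"
    using f(1) by (auto simp: bij_betw_def intro: comp_inj_on)
  moreover have "continuous_map (subtopology (mtopology_of (graph_metric H)) (closed_edge H a)) euclidean (f \<circ> I.\<Phi>)"
    if a: "a \<in> arcs H" for a
  proof (rule continuous_map_compose)
    let ?e = "inv_into (arcs G) \<beta> a"
    have "I.\<Phi> ` closed_edge H a \<subseteq> closed_edge G ?e"
      using I.edge_point_map[OF a] by (auto simp: closed_edge_def)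
    then show "continuous_map (subtopology (mtopology_of (graph_metric H)) (closed_edge H a))
        (subtopology (mtopology_of (graph_metric G)) (closed_edge G ?e)) I.\<Phi>"
      using cont by (auto simp: continuous_map_in_subtopology intro: continuous_map_from_subtopology)
    show "continuous_map (subtopology (mtopology_of (graph_metric G)) (closed_edge G ?e)) euclidean f"
      using f(2) I.arc_in[OF a] by blast
  qed
  ultimately show ?thesis unfolding planar_graph_def by blast
qed

lemma planar_graph_copy:
  fixes G :: "('v, 'e) pre_digraph"
  assumes G: "connected_graph G" and planar: "planar_graph G"
  obtains H :: "(real^2, real^2) pre_digraph" and \<alpha> \<beta> where "graph_iso G H \<alpha> \<beta>"
proof -
  obtain f :: "('v, 'e) graph_point \<Rightarrow> real^2" where f: "inj_on f (graph_points G)"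
    using planar by (auto simp: planar_graph_def)
  define \<alpha> where "\<alpha> v = f (Vertex v)" for v
  \<comment> \<open>Midpoints of distinct edges are distinct points of the realization, so an
    embedding gives each arc its own name in the plane, even if arcs are parallel.\<close>
  define \<beta> where "\<beta> e = f (Inner e (1/2))" for e
  have "Vertex v \<in> graph_points G" if "v \<in> verts G" for v
    using that by (simp add: graph_points_def)
  moreover have "Inner e (1/2) \<in> graph_points G" if "e \<in> arcs G" for e
    using that unfolding graph_points_def by (intro UnI2 CollectI exI[of _ e] exI[of _ "1/2"]) simp
  ultimately have inj: "inj_on \<alpha> (verts G)" "inj_on \<beta> (arcs G)"
    by (auto simp: \<alpha>_def \<beta>_def intro!: inj_onI dest!: inj_onD[OF f])
  define H where "H = \<lparr>verts = \<alpha> ` verts G, arcs = \<beta> ` arcs G,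
    tail = (\<lambda>a. \<alpha> (tail G (inv_into (arcs G) \<beta> a))), head = (\<lambda>a. \<alpha> (head G (inv_into (arcs G) \<beta> a)))\<rparr>"
  have "graph_iso G H \<alpha> \<beta>"
    using G inj by (auto simp: graph_iso_def H_def connected_graph_def bij_betw_def)
  then show thesis by (rule that)
qed

theorem theorem2:
  shows "c\<^sub>2 > 0 \<and>
    (\<forall>m :: 'a metric. geodesic_space m \<and> planar_space m \<longrightarrow> nagata_dim_le m 2 c\<^sub>2) \<and>
    (\<forall>G :: ('v, 'e) pre_digraph.
       connected_graph G \<and> planar_graph G \<longrightarrow> nagata_dim_le (graph_metric G) 2 c\<^sub>2)"
proof -
  let ?P = "\<lambda>c. c > 0 \<and>
     (\<forall>m :: (real^2) metric. geodesic_space m \<and> planar_space m \<longrightarrow> nagata_dim_le m 2 c) \<and>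
     (\<forall>G :: (real^2, real^2) pre_digraph.
        connected_graph G \<and> planar_graph G \<longrightarrow> nagata_dim_le (graph_metric G) 2 c)"
  have "?P 337842"
  proof (intro conjI allI impI)
    fix m :: "(real^2) metric" assume "geodesic_space m \<and> planar_space m"
    then show "nagata_dim_le m 2 337842"
      using planar_geodesic_plane_length_space nagata_dim_plane_length_space
      unfolding planar_space_def by blast
  next
    fix G :: "(real^2, real^2) pre_digraph" assume G: "connected_graph G \<and> planar_graph G"
    then obtain f :: "_ \<Rightarrow> real^2" where "inj_on f (graph_points G)"
      "\<forall>e\<in>arcs G. continuous_map (subtopology (mtopology_of (graph_metric G)) (closed_edge G e)) euclidean f"
      by (auto simp: planar_graph_def)
    then have "plane_length_space (graph_points G) (graph_dist G) (complex_of_vec \<circ> f)"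
      using G planar_graph_plane_length_space by blast
    then show "nagata_dim_le (graph_metric G) 2 337842"
      using G by (intro nagata_dim_plane_length_space) (simp add: graph_metric_simps)
  qed simp
  \<comment> \<open>\<open>337842\<close> only witnesses that the choice is proper. The chosen
    \<open>c\<^sub>2\<close> may be another constant, but it works for all copies over the plane,
    hence for the originals.\<close>
  then have P: "?P c\<^sub>2" unfolding c\<^sub>2_def by (rule someI)
  show ?thesis
  proof (intro conjI allI impI)
    show "c\<^sub>2 > 0" using P by blast
  next
    fix m :: "'a metric" assume m: "geodesic_space m \<and> planar_space m"
    then have "geodesic_space m" "planar_space m" by auto
    then obtain m' :: "(real^2) metric" and \<Phi> where m': "geodesic_space m'" "planar_space m'"
      "bij_betw \<Phi> (mspace m) (mspace m')"
      "\<forall>x\<in>mspace m. \<forall>y\<in>mspace m. mdist m' (\<Phi> x) (\<Phi> y) = mdist m x y"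
      using planar_space_copy by blast
    have "nagata_dim_le m' 2 c\<^sub>2" using P m' by blast
    then show "nagata_dim_le m 2 c\<^sub>2" using m'(3,4) by (blast intro: nagata_dim_isometry)
  next
    fix G :: "('v, 'e) pre_digraph" assume G: "connected_graph G \<and> planar_graph G"
    then obtain H :: "(real^2, real^2) pre_digraph" and \<alpha> \<beta> where iso: "graph_iso G H \<alpha> \<beta>"
      using planar_graph_copy by metis
    have H: "connected_graph H" "planar_graph H"
      using graph_iso.connected_map[OF iso] planar_graph_map[OF iso] G by auto
    then have "nagata_dim_le (graph_metric H) 2 c\<^sub>2" using P by blast
    then show "nagata_dim_le (graph_metric G) 2 c\<^sub>2"
      by (rule nagata_dim_isometry[where \<Phi> = "map_graph_point \<alpha> \<beta>"])
        (use graph_iso_graph_dist(1,2)[OF iso] G H in \<open>simp_all add: graph_metric_simps\<close>)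
  qed
qed

end
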